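(* Let $N,L,H,d_x,V\ge1$ be integers with $H\mid d_x$ and $L>\log_3 d_x$. Let $S_1,S_2$ be two sentences of length $N$ over the vocabulary $[V]$, let $p\in[d_x]$ and $i\in[2N]$, and let $y^{(p,i),L,d_x}_{\mathrm{in\text{-}context}}$ be the $p$-th entry of the in-context representation of $(S_1,S_2)$ at location $i$ (defined in the context). Then there exists an assignment of the network weights for which $$\log\Big[\varepsilon\text{-}\mathrm{seq}\text{-}\mathrm{sep}\big(y^{(p,i),L,d_x}_{\mathrm{in\text{-}context}}\big)\Big]=\tilde\Omega(L\cdot d_x),$$ where $\varepsilon=\tilde O\Big(\binom{3^L+d_x-1}{3^L}^{-1}\Big)$.
   Context: Notation: $[n]=\{1,\dots,n\}$; $\odot$ is the entrywise product; $\tilde O,\tilde\Omega$ omit factors logarithmic in the architecture parameters ($\log d_x,\log L,\log H$). Network. Let $d_a=d_x/H$. The network weights are $\mathcal W=\{W^{\mathrm K,l,h},W^{\mathrm Q,l,h},W^{\mathrm V,l,h},(W^{\mathrm O,l,h})^\top\in\mathbb R^{d_a\times d_x}: l\in[L],h\in[H]\}$ and a vocabulary embedding matrix $M^{\mathrm V}\in\mathbb R^{d_x\times V}$; $E_{M^{\mathrm V}}(w)$ denotes its $w$-th column. For input vectors $\mathbf x^1,\dots,\mathbf x^n\in\mathbb R^{d_x}$ define $\mathbf g^{i,0}_{\mathcal W}=\mathbf x^i$ and, for $l=1,\dots,L$, $$\mathbf g^{i,l}_{\mathcal W}=\sum_{h=1}^H W^{\mathrm O,l,h}\sum_{j=1}^{n}\big\langle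 W^{\mathrm Q,l,h}\mathbf g^{i,l-1}_{\mathcal W},W^{\mathrm K,l,h}\mathbf g^{j,l-1}_{\mathcal W}\big\rangle W^{\mathrm V,l,h}\mathbf g^{j,l-1}_{\mathcal W}.$$ Write $\mathbf g^{i,L}_{\mathcal W}(\mathbf x^1,\dots,\mathbf x^n)\in\mathbb R^{d_x}$ for the output at location $i$. In-context representation. For $S_1=(w_1^1,\dots,w_1^N)$ and $S_2=(w_2^1,\dots,w_2^N)$, the in-context representation at location $i\in[2N]$ is $\mathbf g^{i,L}_{\mathcal W}\big(E_{M^{\mathrm V}}(w_1^1),\dots,E_{M^{\mathrm V}}(w_1^N),E_{M^{\mathrm V}}(w_2^1),\dots,E_{M^{\mathrm V}}(w_2^N)\big)$. With sentence-association variables $\mathbf a,\mathbf b\in\mathbb R^{d_x}$, put $$\mathcal Z(\mathbf a,\mathbf b)=\Big[\mathbf g^{i,L}_{\mathcal W}\big(E_{M^{\mathrm V}}(w_1^1)\odot\mathbf a,\dots,E_{M^{\mathrm V}}(w_1^N)\odot\mathbf a,\,E_{M^{\mathrm V}}(w_2^1)\odot\mathbf b,\dots,E_{M^{\mathrm V}}(w_2^N)\odot\mathbf b\big)\Big]_p .$$ Separation ranks. For a real function $y(A,B)$, $\mathrm{sep}_{(A,B)}(y)$ is the minimal $R$ such that $y(A,B)=\sum_{r=1}^R g_r(A)g'_r(B)$ for some real functions $g_r,g'_r$. For $\varepsilon>0$, $\varepsilon\text{-}\mathrm{sep}_{(A,B)}(y)$ is the minimal $R'\le\mathrm{sep}_{(A,B)}(y)$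 such that there is $\tilde y$ on the same domain with $\mathrm{sep}_{(A,B)}(\tilde y)=R'$ and $|\tilde y-y|\le\varepsilon$ everywhere. Finally $\varepsilon\text{-}\mathrm{seq}\text{-}\mathrm{sep}(y_{\mathrm{in\text{-}context}}):=\varepsilon\text{-}\mathrm{sep}_{(\mathbf a,\mathbf b)}(\mathcal Z)$. *)

theory Defs
  imports Complex_Main "HOL-Library.Extended_Nat" "Jordan_Normal_Form.Matrix"
begin

text \<open>
  All indices are 0-based: layers \<open>l < L\<close>, heads \<open>h < H\<close>, locations \<open>i < 2 * N\<close>,
  entries \<open>p < d\<close>, vocabulary items \<open>w < V\<close>.  Layer \<open>l\<close> maps the
  representations at depth \<open>l\<close> to those at depth \<open>l + 1\<close>.
\<close>

record network =
  WK :: "nat \<Rightarrow> nat \<Rightarrow> real mat"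
  WQ :: "nat \<Rightarrow> nat \<Rightarrow> real mat"
  WV :: "nat \<Rightarrow> nat \<Rightarrow> real mat"
  WO :: "nat \<Rightarrow> nat \<Rightarrow> real mat"
  MV :: "real mat"

definition is_network :: "nat \<Rightarrow> nat \<Rightarrow> nat \<Rightarrow> nat \<Rightarrow> network \<Rightarrow> bool" where
  "is_network L H d V W \<longleftrightarrow>
     (\<forall>l<L. \<forall>h<H.
        WK W l h \<in> carrier_mat (d div H) d \<and>
        WQ W l h \<in> carrier_mat (d div H) d \<and>
        WV W l h \<in> carrier_mat (d div H) d \<and>
        WO W l h \<in> carrier_mat d (d div H)) \<and>
     MV W \<in> carrier_mat d V"

text \<open>
  \<open>attn W H d xs l i\<close> is the representation at location \<open>i\<close> after \<open>l\<close> layers, on the input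
  vectors \<open>xs\<close> of dimension \<open>d\<close>.
\<close>

fun attn :: "network \<Rightarrow> nat \<Rightarrow> nat \<Rightarrow> real vec list \<Rightarrow> nat \<Rightarrow> nat \<Rightarrow> real vec" where
  "attn W H d xs 0 i = xs ! i"
| "attn W H d xs (Suc l) i =
     finsum_vec TYPE(real) d
       (\<lambda>h. WO W l h *\<^sub>v
          finsum_vec TYPE(real) (d div H)
            (\<lambda>j. ((WQ W l h *\<^sub>v attn W H d xs l i) \<bullet> (WK W l h *\<^sub>v attn W H d xs l j)) \<cdot>\<^sub>v
                   (WV W l h *\<^sub>v attn W H d xs l j))
            {..<length xs})
       {..<H}"

definition hadamard :: "real vec \<Rightarrow> real vec \<Rightarrow> real vec" (infixl "\<odot>\<^sub>v" 70) where
  "u \<odot>\<^sub>v v = vec (dim_vec u) (\<lambda>k. u $ k * v $ k)"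

definition embed :: "network \<Rightarrow> nat \<Rightarrow> real vec" where
  "embed W w = col (MV W) w"

definition y_in_context ::
  "network \<Rightarrow> nat \<Rightarrow> nat \<Rightarrow> nat \<Rightarrow> nat list \<Rightarrow> nat list \<Rightarrow> nat \<Rightarrow> nat \<Rightarrow> real" where
  "y_in_context W L H d S1 S2 p i =
     attn W H d (map (embed W) S1 @ map (embed W) S2) L i $ p"

definition Z_in_context ::
  "network \<Rightarrow> nat \<Rightarrow> nat \<Rightarrow> nat \<Rightarrow> nat list \<Rightarrow> nat list \<Rightarrow> nat \<Rightarrow> nat \<Rightarrow>
     real vec \<Rightarrow> real vec \<Rightarrow> real" where
  "Z_in_context W L H d S1 S2 p i a b =
     attn W H d
       (map (\<lambda>w. embed W w \<odot>\<^sub>v a) S1 @ map (\<lambda>w. embed W w \<odot>\<^sub>v b) S2) L i $ p"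

text \<open>
  With trivial sentence-association variables, \<open>Z_in_context\<close> is \<open>y_in_context\<close>.
\<close>

lemma Z_in_context_one:
  assumes "MV W \<in> carrier_mat d V"
  shows "Z_in_context W L H d S1 S2 p i (vec d (\<lambda>_. 1)) (vec d (\<lambda>_. 1)) =
         y_in_context W L H d S1 S2 p i"
proof -
  have "embed W w \<odot>\<^sub>v vec d (\<lambda>_. 1) = embed W w" for w
    using assms by (intro eq_vecI) (auto simp: hadamard_def embed_def)
  then show ?thesis
    by (simp add: Z_in_context_def y_in_context_def)
qed

text \<open>
  Separation ranks of \<open>y\<close> restricted to \<open>X \<times> Y\<close>.  The type \<^typ>\<open>enat\<close> is used because a function
  need not have finite separation rank; then \<open>sep X Y y = \<infinity>\<close> (infimum of the empty set).
\<close>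

definition sep :: "'a set \<Rightarrow> 'b set \<Rightarrow> ('a \<Rightarrow> 'b \<Rightarrow> real) \<Rightarrow> enat" where
  "sep X Y y = Inf {enat R | R.
     \<exists>g g'. \<forall>A\<in>X. \<forall>B\<in>Y. y A B = (\<Sum>r<R. g r A * g' r B)}"

definition eps_sep :: "real \<Rightarrow> 'a set \<Rightarrow> 'b set \<Rightarrow> ('a \<Rightarrow> 'b \<Rightarrow> real) \<Rightarrow> enat" where
  "eps_sep \<epsilon> X Y y = Inf {R'. R' \<le> sep X Y y \<and>
     (\<exists>y'. sep X Y y' = R' \<and> (\<forall>A\<in>X. \<forall>B\<in>Y. \<bar>y' A B - y A B\<bar> \<le> \<epsilon>))}"

definition eps_seq_sep ::
  "real \<Rightarrow> network \<Rightarrow> nat \<Rightarrow> nat \<Rightarrow> nat \<Rightarrow> nat list \<Rightarrow> nat list \<Rightarrow> nat \<Rightarrow> nat \<Rightarrow> enat" where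
  "eps_seq_sep \<epsilon> W L H d S1 S2 p i =
     eps_sep \<epsilon> (carrier_vec d) (carrier_vec d) (Z_in_context W L H d S1 S2 p i)"

text \<open>
  The logarithmic factors hidden by the soft asymptotic notation are the powers of \<open>arch_log\<close>.
  The summand 1 keeps the factor positive when all three parameters are 1; any product of powers
  of \<open>ln d\<close>, \<open>ln L\<close> and \<open>ln H\<close> is at most a power of \<open>arch_log\<close>.
\<close>

definition arch_log :: "nat \<Rightarrow> nat \<Rightarrow> nat \<Rightarrow> real" where
  "arch_log L H d = 1 + ln (real d) + ln (real L) + ln (real H)"

end

theory Submission
  imports Defs "HOL-Computational_Algebra.Polynomial"
begin

text \<open>
  With the all-ones vocabulary matrix the inputs are \<open>N\<close> copies of \<open>a\<close> followed by \<open>N\<close> copies of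
  \<open>b\<close>, whatever the sentences are. If all heads write to entry \<open>p\<close> only, reading entry \<open>p\<close> of the
  value vectors, then for any number of heads one layer computes a sum of products of chosen entries
  of its query and key vectors. For \<open>d \<ge> 6\<close> the first layer pairs \<open>m + 1\<close> entries of the one
  sentence with \<open>m + 1\<close> other entries of the other sentence, where \<open>m = d div 6\<close>, and each later
  layer cubes entry \<open>p\<close>. On the curves
  with entries \<open>T ^ e t\<close> and \<open>S ^ e t\<close>, where \<open>e\<close> takes the values \<open>1\<close> and \<open>1 + b ^ t\<close> for \<open>t < m\<close>, the
  output is \<open>(\<Sum>t\<le>m. (T * S) ^ e t) ^ 3 ^ (L - 1)\<close>, and expansion in base
  \<open>b = 3 ^ (L - 1) div m + 1\<close> shows that at least \<open>b ^ m\<close> powers of \<open>T * S\<close> occur in it. For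
  \<open>d \<le> 5\<close> it suffices that a network acting on entry \<open>p\<close> alone computes
  \<open>T * (T\<^sup>2 + S\<^sup>2) ^ ((3 ^ L - 1) div 2)\<close>.

  The number of monomials \<open>T ^ \<alpha> k * S ^ \<beta> k\<close> with distinct \<open>\<alpha> k > 0\<close> and distinct \<open>\<beta> k\<close> bounds the
  rank of every uniform approximation from below, however large \<open>\<epsilon>\<close> is, because \<open>T\<close> ranges over an
  unbounded set.
\<close>

section \<open>Separation rank\<close>

text \<open>Closure of this property under sums, products and powers makes the rank of the
  polynomial network outputs finite, as the natural number \<open>R\<close> in the theorem
  requires.\<close>

definition finite_sep :: "'a set \<Rightarrow> 'b set \<Rightarrow> ('a \<Rightarrow> 'b \<Rightarrow> real) \<Rightarrow> bool" where
  "finite_sep X Y f \<longleftrightarrow>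
     (\<exists>(R::nat) g g'. \<forall>A\<in>X. \<forall>B\<in>Y. f A B = (\<Sum>r<R. g r A * g' r B))"

lemma finite_sep_zero: "finite_sep X Y (\<lambda>A B. 0)"
  unfolding finite_sep_def by (rule exI[of _ 0]) simp

lemma finite_sep_add_product:
  assumes "finite_sep X Y f"
  shows "finite_sep X Y (\<lambda>A B. f A B + g A * g' B)"
proof -
  obtain R :: nat and u u' where "\<forall>A\<in>X. \<forall>B\<in>Y. f A B = (\<Sum>r<R. u r A * u' r B)"
    using assms unfolding finite_sep_def by blast
  then have "\<forall>A\<in>X. \<forall>B\<in>Y. f A B + g A * g' B =
      (\<Sum>r<Suc R. (u(R := g)) r A * (u'(R := g')) r B)"
    by simp
  then show ?thesis
    unfolding finite_sep_def by blast
qed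

lemma finite_sep_product: "finite_sep X Y (\<lambda>A B. g A * g' B)"
  using finite_sep_add_product[OF finite_sep_zero, of X Y g g'] by simp

lemma finite_sep_cong:
  assumes "finite_sep X Y f" "\<And>A B. A \<in> X \<Longrightarrow> B \<in> Y \<Longrightarrow> f' A B = f A B"
  shows "finite_sep X Y f'"
  using assms unfolding finite_sep_def by simp

lemma finite_sep_add:
  assumes "finite_sep X Y f" "finite_sep X Y f'"
  shows "finite_sep X Y (\<lambda>A B. f A B + f' A B)"
proof -
  obtain R :: nat and u u' where R: "\<forall>A\<in>X. \<forall>B\<in>Y. f' A B = (\<Sum>r<R. u r A * u' r B)"
    using assms(2) unfolding finite_sep_def by blast
  have "finite_sep X Y (\<lambda>A B. f A B + (\<Sum>r<n. u r A * u' r B))" for n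
  proof (induction n)
    case (Suc n)
    from finite_sep_add_product[OF Suc, of "u n" "u' n"] show ?case
      by (simp add: add.assoc)
  qed (use assms(1) in simp)
  from finite_sep_cong[OF this[of R]] R show ?thesis by simp
qed

lemma finite_sep_sum:
  assumes "\<And>t. t < (n::nat) \<Longrightarrow> finite_sep X Y (f t)"
  shows "finite_sep X Y (\<lambda>A B. \<Sum>t<n. f t A B)"
  using assms by (induction n) (auto intro: finite_sep_zero finite_sep_add)

lemma finite_sep_mult:
  assumes "finite_sep X Y f" "finite_sep X Y f'"
  shows "finite_sep X Y (\<lambda>A B. f A B * f' A B)"
proof -
  obtain R :: nat and u u' where R: "\<forall>A\<in>X. \<forall>B\<in>Y. f A B = (\<Sum>r<R. u r A * u' r B)"
    using assms(1) unfolding finite_sep_def by blast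
  obtain R' :: nat and v v' where R': "\<forall>A\<in>X. \<forall>B\<in>Y. f' A B = (\<Sum>r<R'. v r A * v' r B)"
    using assms(2) unfolding finite_sep_def by blast
  have "finite_sep X Y (\<lambda>A B. \<Sum>r<R. \<Sum>s<R'. (u r A * v s A) * (u' r B * v' s B))"
    by (intro finite_sep_sum finite_sep_product)
  then show ?thesis
    by (rule finite_sep_cong) (simp add: R R' sum_product mult_ac)
qed

lemma finite_sep_power:
  assumes "finite_sep X Y f"
  shows "finite_sep X Y (\<lambda>A B. f A B ^ n)"
proof (induction n)
  case 0
  show ?case using finite_sep_product[of X Y "\<lambda>_. 1" "\<lambda>_. 1"] by simp
next
  case (Suc n)
  then show ?case by (simp add: finite_sep_mult assms)
qed

lemma finite_sep_swap:
  assumes "finite_sep X Y f"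
  shows "finite_sep Y X (\<lambda>B A. f A B)"
proof -
  obtain R :: nat and u u' where R: "\<forall>A\<in>X. \<forall>B\<in>Y. f A B = (\<Sum>r<R. u r A * u' r B)"
    using assms unfolding finite_sep_def by blast
  then have "\<forall>B\<in>Y. \<forall>A\<in>X. f A B = (\<Sum>r<R. u' r B * u r A)"
    by (simp add: mult.commute)
  then show ?thesis unfolding finite_sep_def by blast
qed

text \<open>A finite infimum rules out the empty set, and \<open>enat\<close> is well-ordered, so
  the minimum is realised by a decomposition.\<close>

lemma sep_attained:
  assumes "sep X Y y = enat R"
  obtains g g' where "\<And>A B. A \<in> X \<Longrightarrow> B \<in> Y \<Longrightarrow> y A B = (\<Sum>r<R. g r A * g' r B)"
proof -
  let ?S = "{enat R | R. \<exists>g g'. \<forall>A\<in>X. \<forall>B\<in>Y. y A B = (\<Sum>r<R. g r A * g' r B)}"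
  have "?S \<noteq> {}"
  proof
    assume "?S = {}"
    then have "sep X Y y = \<infinity>"
      unfolding sep_def by (simp only: Inf_empty top_enat_def)
    then show False using assms by simp
  qed
  then have "Inf ?S \<in> ?S"
    by (metis (no_types, lifting) LeastI Inf_enat_def ex_in_conv)
  then show ?thesis
    using assms that unfolding sep_def by auto
qed

lemma sep_finite:
  assumes "finite_sep X Y y"
  shows "sep X Y y \<noteq> \<infinity>"
proof -
  obtain R :: nat and u u' where "\<forall>A\<in>X. \<forall>B\<in>Y. y A B = (\<Sum>r<R. u r A * u' r B)"
    using assms unfolding finite_sep_def by blast
  then have "sep X Y y \<le> enat R"
    unfolding sep_def by (intro Inf_lower) blast
  then show ?thesis by (metis enat_ord_simps(5) infinity_ileE)
qed

text \<open>As \<open>y\<close> approximates itself, the set of admissible ranks is nonempty and its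
  minimum is attained; finite \<open>sep\<close> keeps it finite.\<close>

lemma eps_sep_attained:
  assumes "finite_sep X Y y" "0 < \<epsilon>"
  obtains R y' g g' where "eps_sep \<epsilon> X Y y = enat R"
    "\<And>A B. A \<in> X \<Longrightarrow> B \<in> Y \<Longrightarrow> \<bar>y' A B - y A B\<bar> \<le> \<epsilon>"
    "\<And>A B. A \<in> X \<Longrightarrow> B \<in> Y \<Longrightarrow> y' A B = (\<Sum>r<R. g r A * g' r B)"
proof -
  let ?S = "{R'. R' \<le> sep X Y y \<and>
     (\<exists>y'. sep X Y y' = R' \<and> (\<forall>A\<in>X. \<forall>B\<in>Y. \<bar>y' A B - y A B\<bar> \<le> \<epsilon>))}"
  have "sep X Y y \<in> ?S"
    using assms(2) by (auto intro!: exI[of _ y])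
  then have "Inf ?S \<in> ?S"
    by (metis (no_types, lifting) LeastI Inf_enat_def empty_iff)
  then obtain y' where y': "eps_sep \<epsilon> X Y y \<le> sep X Y y" "sep X Y y' = eps_sep \<epsilon> X Y y"
    "\<forall>A\<in>X. \<forall>B\<in>Y. \<bar>y' A B - y A B\<bar> \<le> \<epsilon>"
    unfolding eps_sep_def by blast
  then obtain R where R: "eps_sep \<epsilon> X Y y = enat R"
    using sep_finite[OF assms(1)] by (cases "eps_sep \<epsilon> X Y y") auto
  obtain g g' where "\<And>A B. A \<in> X \<Longrightarrow> B \<in> Y \<Longrightarrow> y' A B = (\<Sum>r<R. g r A * g' r B)"
    by (rule sep_attained[OF y'(2)[unfolded R]]) (rule that)
  then show ?thesis
    using that R y'(3) by blast
qed

section \<open>Functionals on powers and ranks of approximations\<close>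

text \<open>Gaussian elimination: each induction step uses one equation with a nonzero pivot, if it
  has any, to remove one unknown.\<close>

lemma underdetermined_solution:
  fixes G :: "'a \<Rightarrow> nat \<Rightarrow> real"
  assumes "finite E" "R < card E"
  shows "\<exists>x. (\<exists>k\<in>E. x k \<noteq> 0) \<and> (\<forall>r<R. (\<Sum>k\<in>E. x k * G k r) = 0)"
  using assms
proof (induction R arbitrary: E G)
  case 0
  then have "E \<noteq> {}" by auto
  then show ?case by (intro exI[of _ "\<lambda>_. 1"]) auto
next
  case (Suc R)
  show ?case
  proof (cases "\<forall>k\<in>E. G k R = 0")
    case True
    obtain x where "\<exists>k\<in>E. x k \<noteq> 0" "\<forall>r<R. (\<Sum>k\<in>E. x k * G k r) = 0"
      using Suc.IH[OF Suc.prems(1), of G] Suc.prems(2) by auto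
    then show ?thesis
      using True by (intro exI[of _ x]) (auto simp: less_Suc_eq)
  next
    case False
    then obtain k0 where k0: "k0 \<in> E" "G k0 R \<noteq> 0" by blast
    let ?E = "E - {k0}"
    \<comment> \<open>\<open>?G\<close> is the system left after equation \<open>R\<close>
      eliminates the unknown \<open>k0\<close>; \<open>c\<close> below is the value of that unknown
      by back substitution.\<close>
    let ?G = "\<lambda>k r. G k r - G k R / G k0 R * G k0 r"
    have "R < card ?E" using Suc.prems k0 by simp
    then obtain x where x: "\<exists>k\<in>?E. x k \<noteq> 0" "\<forall>r<R. (\<Sum>k\<in>?E. x k * ?G k r) = 0"
      using Suc.IH[of ?E ?G] Suc.prems(1) by auto
    define c where "c = - (\<Sum>k\<in>?E. x k * (G k R / G k0 R))"
    have split: "(\<Sum>k\<in>E. (x(k0 := c)) k * G k r) = c * G k0 r + (\<Sum>k\<in>?E. x k * G k r)" for r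
    proof -
      have "(\<Sum>k\<in>E. (x(k0 := c)) k * G k r) =
          c * G k0 r + (\<Sum>k\<in>?E. (x(k0 := c)) k * G k r)"
        using Suc.prems(1) k0(1) by (subst sum.remove[of E k0]) auto
      also have "(\<Sum>k\<in>?E. (x(k0 := c)) k * G k r) = (\<Sum>k\<in>?E. x k * G k r)"
        by (rule sum.cong) auto
      finally show ?thesis .
    qed
    have eq: "c * G k0 r + (\<Sum>k\<in>?E. x k * G k r) = (\<Sum>k\<in>?E. x k * ?G k r)" for r
      by (simp add: c_def right_diff_distrib sum_subtractf sum_distrib_right mult.assoc)
    have "(\<Sum>k\<in>?E. x k * ?G k R) = 0"
      using k0(2) by simp
    then have "\<forall>r<Suc R. (\<Sum>k\<in>E. (x(k0 := c)) k * G k r) = 0"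
      using x(2) unfolding split eq less_Suc_eq by blast
    moreover have "\<exists>k\<in>E. (x(k0 := c)) k \<noteq> 0"
      using x(1) by auto
    ultimately show ?thesis by blast
  qed
qed

text \<open>Nonzero weights that kill the \<open>M\<close> powers other than \<open>k\<close> exist
  by a dimension count. They cannot kill the power \<open>k\<close> too, since a Lagrange polynomial
  detects any nonzero weight; it remains to normalise.\<close>

lemma ex_coefficient_functional:
  assumes "k \<le> M"
  shows "\<exists>w::nat \<Rightarrow> real. \<forall>j\<le>M. (\<Sum>i\<le>M. w i * real i ^ j) = of_bool (j = k)"
proof -
  \<comment> \<open>\<open>s\<close> lists the \<open>M\<close> exponents in \<open>{..M}\<close>
    other than \<open>k\<close>.\<close>
  define s where "s r = (if r < k then r else Suc r)" for r
  obtain w :: "nat \<Rightarrow> real" where nz: "\<exists>i\<le>M. w i \<noteq> 0"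
    and w: "\<forall>r<M. (\<Sum>i\<le>M. w i * real i ^ s r) = 0"
    using underdetermined_solution[of "{..M}" M "\<lambda>i r. real i ^ s r"] by auto
  have w0: "(\<Sum>i\<le>M. w i * real i ^ j) = 0" if "j \<le> M" "j \<noteq> k" for j
  proof -
    have "\<exists>r<M. s r = j"
      using that assms by (intro exI[of _ "if j < k then j else j - 1"]) (auto simp: s_def)
    then show ?thesis using w by blast
  qed
  define K where "K = (\<Sum>i\<le>M. w i * real i ^ k)"
  have "K \<noteq> 0"
  proof
    assume "K = 0"
    with w0 have w0: "(\<Sum>i\<le>M. w i * real i ^ j) = 0" if "j \<le> M" for j
      using that unfolding K_def by (cases "j = k") auto
    have pw: "(\<Sum>i\<le>M. w i * poly p (real i)) = 0" if "degree p \<le> M" for p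
    proof -
      have "poly p x = (\<Sum>j\<le>M. coeff p j * x ^ j)" for x
        unfolding poly_altdef using that
        by (intro sum.mono_neutral_left) (auto simp: coeff_eq_0)
      then have "(\<Sum>i\<le>M. w i * poly p (real i)) =
          (\<Sum>i\<le>M. \<Sum>j\<le>M. coeff p j * (w i * real i ^ j))"
        by (simp add: sum_distrib_left mult_ac)
      also have "\<dots> = (\<Sum>j\<le>M. coeff p j * (\<Sum>i\<le>M. w i * real i ^ j))"
        by (subst sum.swap) (simp add: sum_distrib_left)
      finally show ?thesis by (simp add: w0)
    qed
    from nz obtain i where i: "i \<le> M" "w i \<noteq> 0" by blast
    \<comment> \<open>\<open>p\<close> vanishes at every node except \<open>i\<close>, so its
      weighted sum is \<open>w i * poly p (real i)\<close>, a product of nonzero factors.\<close>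
    define p where "p = (\<Prod>i'\<in>{..M} - {i}. [:- real i', 1:])"
    have "degree p \<le> (\<Sum>i'\<in>{..M} - {i}. degree [:- real i', 1:])"
      unfolding p_def by (rule degree_prod_sum_le[unfolded o_def]) simp
    also have "\<dots> = M" using i by simp
    finally have "0 = (\<Sum>i'\<le>M. w i' * poly p (real i'))" using pw by simp
    also have "\<dots> = w i * poly p (real i) + (\<Sum>i'\<in>{..M} - {i}. w i' * poly p (real i'))"
      using i by (subst sum.remove[of _ i]) auto
    also have "(\<Sum>i'\<in>{..M} - {i}. w i' * poly p (real i')) = 0"
      by (intro sum.neutral ballI) (auto simp: p_def poly_prod)
    finally have "poly p (real i) = 0" using i by simp
    then show False by (auto simp: p_def poly_prod)
  qed
  then have "\<forall>j\<le>M. (\<Sum>i\<le>M. (w i / K) * real i ^ j) = of_bool (j = k)"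
    using w0 by (auto simp: K_def simp flip: sum_divide_distrib)
  then show ?thesis by (rule exI[of _ "\<lambda>i. w i / K"])
qed

text \<open>Stretching the nodes by \<open>\<mu>\<close> divides the weights by
  \<open>\<mu> ^ k\<close>. For positive \<open>k\<close> they become arbitrarily small, while the
  functional stays exact on all powers up to \<open>M\<close>.\<close>

lemma ex_small_coefficient_functional:
  assumes "0 < k" "k \<le> M" "0 < (\<delta>::real)"
  shows "\<exists>w t::nat \<Rightarrow> real. (\<forall>j\<le>M. (\<Sum>i\<le>M. w i * t i ^ j) = of_bool (j = k)) \<and>
    (\<Sum>i\<le>M. \<bar>w i\<bar>) \<le> \<delta>"
proof -
  obtain w :: "nat \<Rightarrow> real" where w: "\<forall>j\<le>M. (\<Sum>i\<le>M. w i * real i ^ j) = of_bool (j = k)"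
    using ex_coefficient_functional[OF assms(2)] by blast
  define K where "K = (\<Sum>i\<le>M. \<bar>w i\<bar>)"
  \<comment> \<open>The lower bound 1 gives \<open>\<mu> \<le> \<mu> ^ k\<close>, so a bound linear
    in \<open>\<mu>\<close> suffices.\<close>
  define \<mu> where "\<mu> = max 1 (K / \<delta>)"
  have \<mu>: "\<mu> \<ge> 1" "K \<le> \<delta> * \<mu>"
    using assms(3) by (auto simp: \<mu>_def max_def field_simps)
  have "\<mu> \<le> \<mu> ^ k"
    using \<mu>(1) assms(1) power_increasing[of 1 k \<mu>] by simp
  then have K: "K \<le> \<delta> * \<mu> ^ k"
    using \<mu>(2) assms(3) by (meson mult_left_mono order_trans less_imp_le)
  have "(\<Sum>i\<le>M. (w i / \<mu> ^ k) * (\<mu> * real i) ^ j) = of_bool (j = k)" if "j \<le> M" for j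
  proof -
    have "(\<Sum>i\<le>M. (w i / \<mu> ^ k) * (\<mu> * real i) ^ j) =
        \<mu> ^ j / \<mu> ^ k * (\<Sum>i\<le>M. w i * real i ^ j)"
      unfolding sum_distrib_left by (rule sum.cong) (auto simp: power_mult_distrib)
    then show ?thesis using w that \<mu>(1) by auto
  qed
  moreover have "(\<Sum>i\<le>M. \<bar>w i / \<mu> ^ k\<bar>) \<le> \<delta>"
  proof -
    have "(\<Sum>i\<le>M. \<bar>w i / \<mu> ^ k\<bar>) = K / \<mu> ^ k"
      using \<mu>(1) by (simp add: K_def sum_divide_distrib)
    also have "\<dots> \<le> \<delta>"
      using K \<mu>(1) by (subst pos_divide_le_eq) auto
    finally show ?thesis .
  qed
  ultimately show ?thesis
    by (intro exI[of _ "\<lambda>i. w i / \<mu> ^ k"] exI[of _ "\<lambda>i. \<mu> * real i"]) simp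
qed

text \<open>
  Small coefficient functionals in the first variable turn an approximation \<open>y\<close> of the kernel into
  a matrix within \<open>1 / (2 * card E)\<close> of the identity, whatever \<open>\<epsilon>\<close> is.
\<close>

lemma approximate_monomial_kernel_rank:
  fixes c :: "'k \<Rightarrow> real" and \<alpha> \<beta> :: "'k \<Rightarrow> nat" and y :: "real \<Rightarrow> real \<Rightarrow> real"
  assumes E: "finite E" "inj_on \<alpha> E" "inj_on \<beta> E"
    and c: "\<And>k. k \<in> E \<Longrightarrow> c k \<noteq> 0" and \<alpha>: "\<And>k. k \<in> E \<Longrightarrow> 0 < \<alpha> k"
    and close: "\<And>T S. \<bar>y T S - (\<Sum>k\<in>E. c k * T ^ \<alpha> k * S ^ \<beta> k)\<bar> \<le> \<epsilon>"
    and y: "\<And>T S. y T S = (\<Sum>r<R. g r T * g' r S)"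
  shows "card E \<le> R"
proof (rule ccontr)
  assume "\<not> card E \<le> R"
  then have R: "R < card E" by simp
  then have n: "0 < real (card E)" by simp
  define M where "M = (\<Sum>k\<in>E. \<alpha> k + \<beta> k)"
  have M: "\<alpha> k \<le> M" "\<beta> k \<le> M" if "k \<in> E" for k
    using member_le_sum[of k E "\<lambda>k. \<alpha> k + \<beta> k"] that E(1) unfolding M_def by auto
  have \<epsilon>: "0 \<le> \<epsilon>"
    using close[of 0 0] by linarith
  have "\<forall>l\<in>E. \<exists>w::nat \<Rightarrow> real. \<forall>j\<le>M. (\<Sum>i\<le>M. w i * real i ^ j) = of_bool (j = \<beta> l)"
    using ex_coefficient_functional M(2) by blast
  then obtain v :: "'k \<Rightarrow> nat \<Rightarrow> real" where
    v: "\<And>l j. l \<in> E \<Longrightarrow> j \<le> M \<Longrightarrow> (\<Sum>i\<le>M. v l i * real i ^ j) = of_bool (j = \<beta> l)"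
    by metis
  define K where "K = (\<Sum>l\<in>E. \<Sum>j\<le>M. \<bar>v l j\<bar>)"
  have K: "(\<Sum>j\<le>M. \<bar>v l j\<bar>) \<le> K" if "l \<in> E" for l
    unfolding K_def by (rule member_le_sum[OF that]) (auto intro: sum_nonneg E(1))
  have K0: "0 \<le> K"
    unfolding K_def by (intro sum_nonneg) auto
  \<comment> \<open>Chosen for \<open>\<epsilon> * \<delta> * K \<le> 1 / (2 * card E)\<close>; the
    summands 1 keep the denominator positive.\<close>
  define \<delta> where "\<delta> = 1 / (2 * real (card E) * (1 + \<epsilon>) * (1 + K))"
  have \<delta>: "0 < \<delta>"
    unfolding \<delta>_def using n \<epsilon> K0 by simp
  have \<delta>': "\<epsilon> * \<delta> * K \<le> 1 / (2 * real (card E))"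
  proof -
    have "\<epsilon> * \<delta> * K = (\<epsilon> / (1 + \<epsilon>)) * (K / (1 + K)) * (1 / (2 * real (card E)))"
      unfolding \<delta>_def using n \<epsilon> K0 by (simp add: field_simps)
    also have "\<dots> \<le> 1 * 1 * (1 / (2 * real (card E)))"
      by (intro mult_mono) (use n \<epsilon> K0 in auto)
    finally show ?thesis by simp
  qed
  \<comment> \<open>The factor \<open>\<bar>c k\<bar>\<close> anticipates the division of row
    \<open>k\<close> by \<open>c k\<close>.\<close>
  have "\<forall>k\<in>E. \<exists>w t::nat \<Rightarrow> real.
      (\<forall>j\<le>M. (\<Sum>i\<le>M. w i * t i ^ j) = of_bool (j = \<alpha> k)) \<and> (\<Sum>i\<le>M. \<bar>w i\<bar>) \<le> \<bar>c k\<bar> * \<delta>"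
    using ex_small_coefficient_functional M(1) \<alpha> c \<delta> by simp
  then obtain w t :: "'k \<Rightarrow> nat \<Rightarrow> real" where wt: "\<forall>k\<in>E.
      (\<forall>j\<le>M. (\<Sum>i\<le>M. w k i * t k i ^ j) = of_bool (j = \<alpha> k)) \<and> (\<Sum>i\<le>M. \<bar>w k i\<bar>) \<le> \<bar>c k\<bar> * \<delta>"
    unfolding bchoice_iff by blast
  have w: "(\<Sum>i\<le>M. w k i * t k i ^ j) = of_bool (j = \<alpha> k)" if "k \<in> E" "j \<le> M" for k j
    using wt that by blast
  have w_small: "(\<Sum>i\<le>M. \<bar>w k i\<bar>) \<le> \<bar>c k\<bar> * \<delta>" if "k \<in> E" for k
    using wt that by blast
  \<comment> \<open>\<open>\<Lambda> k l\<close> extracts the coefficient of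
    \<open>T ^ \<alpha> k * S ^ \<beta> l\<close>. It is diagonal on the kernel because the
    exponents are distinct, and on the factorised \<open>y\<close> it has rank at most
    \<open>R\<close>.\<close>
  define \<Lambda> where "\<Lambda> k l f = (\<Sum>i\<le>M. \<Sum>j\<le>M. w k i * v l j * f (t k i) (real j))"
    for k l and f :: "real \<Rightarrow> real \<Rightarrow> real"
  have \<Lambda>_product: "\<Lambda> k l (\<lambda>T S. u T * u' S) =
      (\<Sum>i\<le>M. w k i * u (t k i)) * (\<Sum>j\<le>M. v l j * u' (real j))" for k l u u'
    unfolding \<Lambda>_def sum_product by (simp add: mult_ac)
  have \<Lambda>_sum: "\<Lambda> k l (\<lambda>T S. \<Sum>q\<in>Q. f q T S) = (\<Sum>q\<in>Q. \<Lambda> k l (f q))"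
    for k l and Q :: "'q set" and f
  proof -
    have "\<Lambda> k l (\<lambda>T S. \<Sum>q\<in>Q. f q T S) =
        (\<Sum>i\<le>M. \<Sum>q\<in>Q. \<Sum>j\<le>M. w k i * v l j * f q (t k i) (real j))"
      unfolding \<Lambda>_def sum_distrib_left by (subst (2) sum.swap) simp
    then show ?thesis
      unfolding \<Lambda>_def by (subst (asm) sum.swap)
  qed
  have \<Lambda>_kernel: "\<Lambda> k l (\<lambda>T S. \<Sum>q\<in>E. c q * T ^ \<alpha> q * S ^ \<beta> q) = of_bool (k = l) * c k"
    if "k \<in> E" "l \<in> E" for k l
  proof -
    have "\<Lambda> k l (\<lambda>T S. \<Sum>q\<in>E. c q * T ^ \<alpha> q * S ^ \<beta> q) =
        (\<Sum>q\<in>E. \<Lambda> k l (\<lambda>T S. (c q * T ^ \<alpha> q) * S ^ \<beta> q))"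
      by (rule \<Lambda>_sum)
    also have "\<dots> = (\<Sum>q\<in>E. c q * of_bool (\<alpha> q = \<alpha> k) * of_bool (\<beta> q = \<beta> l))"
    proof (rule sum.cong[OF refl])
      fix q assume "q \<in> E"
      have "(\<Sum>i\<le>M. w k i * (c q * t k i ^ \<alpha> q)) = c q * (\<Sum>i\<le>M. w k i * t k i ^ \<alpha> q)"
        by (simp add: sum_distrib_left mult_ac)
      then show "\<Lambda> k l (\<lambda>T S. (c q * T ^ \<alpha> q) * S ^ \<beta> q) =
          c q * of_bool (\<alpha> q = \<alpha> k) * of_bool (\<beta> q = \<beta> l)"
        using M[OF \<open>q \<in> E\<close>] that by (simp only: \<Lambda>_product w v)
    qed
    also have "\<dots> = (\<Sum>q\<in>E. if q = k then of_bool (k = l) * c k else 0)"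
      using that E by (intro sum.cong) (auto simp: inj_on_eq_iff)
    finally show ?thesis
      using that(1) E(1) by simp
  qed
  have \<Lambda>_small: "\<bar>\<Lambda> k l f\<bar> \<le> \<bar>c k\<bar> * (1 / (2 * real (card E)))"
    if "k \<in> E" "l \<in> E" "\<And>T S. \<bar>f T S\<bar> \<le> \<epsilon>" for k l f
  proof -
    have "\<bar>\<Lambda> k l f\<bar> \<le> (\<Sum>i\<le>M. \<Sum>j\<le>M. \<bar>w k i\<bar> * \<bar>v l j\<bar> * \<epsilon>)"
      unfolding \<Lambda>_def using that(3)
      by (intro order.trans[OF sum_abs] sum_mono) (auto simp: abs_mult intro: mult_left_mono)
    also have "\<dots> = (\<Sum>i\<le>M. \<bar>w k i\<bar>) * (\<Sum>j\<le>M. \<bar>v l j\<bar>) * \<epsilon>"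
      by (subst sum_product) (simp add: sum_distrib_right)
    also have "\<dots> \<le> (\<bar>c k\<bar> * \<delta>) * K * \<epsilon>"
      using w_small[OF that(1)] K[OF that(2)] \<epsilon> \<delta>
      by (intro mult_right_mono mult_mono) (auto intro: sum_nonneg)
    also have "\<dots> = \<bar>c k\<bar> * (\<epsilon> * \<delta> * K)" by simp
    also have "\<dots> \<le> \<bar>c k\<bar> * (1 / (2 * real (card E)))"
      using \<delta>' by (rule mult_left_mono) simp
    finally show ?thesis .
  qed
  define G where "G k r = (\<Sum>i\<le>M. w k i * g r (t k i))" for k r
  define G' where "G' l r = (\<Sum>j\<le>M. v l j * g' r (real j))" for l r
  have \<Lambda>_y: "\<Lambda> k l y = (\<Sum>r<R. G k r * G' l r)" for k l
  proof -
    have "y = (\<lambda>T S. \<Sum>r<R. g r T * g' r S)" using y by (intro ext)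
    then have "\<Lambda> k l y = (\<Sum>r<R. \<Lambda> k l (\<lambda>T S. g r T * g' r S))"
      by (simp only: \<Lambda>_sum)
    then show ?thesis by (simp only: \<Lambda>_product G_def G'_def)
  qed
  \<comment> \<open>\<open>e\<close> is the deviation of the matrix
    \<open>\<Lambda> k l y / c k\<close> from the identity.\<close>
  define e where "e k l = (\<Lambda> k l y - of_bool (k = l) * c k) / c k" for k l
  have e: "\<bar>e k l\<bar> \<le> 1 / (2 * real (card E))" if "k \<in> E" "l \<in> E" for k l
  proof -
    have "\<Lambda> k l y - of_bool (k = l) * c k =
        \<Lambda> k l (\<lambda>T S. y T S - (\<Sum>q\<in>E. c q * T ^ \<alpha> q * S ^ \<beta> q))"
      using \<Lambda>_kernel[OF that] unfolding \<Lambda>_def by (simp add: right_diff_distrib sum_subtractf)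
    then have "\<bar>\<Lambda> k l y - of_bool (k = l) * c k\<bar> \<le> \<bar>c k\<bar> * (1 / (2 * real (card E)))"
      using \<Lambda>_small[OF that close] by simp
    then show ?thesis
      unfolding e_def abs_divide using c[OF that(1)] by (subst pos_divide_le_eq) (auto simp: mult.commute)
  qed
  \<comment> \<open>The rows of this matrix are linearly dependent, as \<open>R < card E\<close>. At
    an index \<open>l\<close> where the dependence \<open>x\<close> is largest, the perturbation
    contributes at most half of the diagonal term, so the two cannot cancel.\<close>
  obtain x where x: "\<exists>k\<in>E. x k \<noteq> 0" "\<forall>r<R. (\<Sum>k\<in>E. x k * (G k r / c k)) = 0"
    using underdetermined_solution[OF E(1) R, of "\<lambda>k r. G k r / c k"] by auto
  have "E \<noteq> {}" using n by auto
  then have "Max ((\<lambda>k. \<bar>x k\<bar>) ` E) \<in> (\<lambda>k. \<bar>x k\<bar>) ` E"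
    using E(1) by (intro Max_in) auto
  then obtain l where l: "l \<in> E" "Max ((\<lambda>k. \<bar>x k\<bar>) ` E) = \<bar>x l\<bar>" by auto
  have x_le: "\<bar>x k\<bar> \<le> \<bar>x l\<bar>" if "k \<in> E" for k
    unfolding l(2)[symmetric] using that E(1) by (intro Max_ge) auto
  then have xl: "\<bar>x l\<bar> > 0" using x(1) by fastforce
  have "(\<Sum>k\<in>E. x k * (\<Lambda> k l y / c k)) = (\<Sum>k\<in>E. \<Sum>r<R. x k * (G k r / c k) * G' l r)"
    by (simp add: \<Lambda>_y sum_divide_distrib sum_distrib_left mult.assoc)
  also have "\<dots> = (\<Sum>r<R. (\<Sum>k\<in>E. x k * (G k r / c k)) * G' l r)"
    by (subst sum.swap) (simp add: sum_distrib_right)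
  also have "\<dots> = 0" using x(2) by simp
  also have "(\<Sum>k\<in>E. x k * (\<Lambda> k l y / c k)) = (\<Sum>k\<in>E. x k * of_bool (k = l) + x k * e k l)"
    using c by (intro sum.cong) (auto simp: e_def field_simps)
  also have "\<dots> = x l + (\<Sum>k\<in>E. x k * e k l)"
    using l(1) E(1) by (simp add: sum.distrib if_distrib[of "\<lambda>z. _ * z"] of_bool_def cong: if_cong)
  finally have "\<bar>x l\<bar> = \<bar>\<Sum>k\<in>E. x k * e k l\<bar>" by linarith
  also have "\<dots> \<le> (\<Sum>k\<in>E. \<bar>x k * e k l\<bar>)" by (rule sum_abs)
  also have "\<dots> \<le> (\<Sum>k\<in>E. \<bar>x l\<bar> * (1 / (2 * real (card E))))"
    unfolding abs_mult using x_le e l(1) by (intro sum_mono mult_mono) auto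
  also have "\<dots> = \<bar>x l\<bar> / 2" using n by simp
  finally show False using xl by simp
qed

lemma eps_sep_ge_card:
  fixes z :: "'a \<Rightarrow> 'a \<Rightarrow> real" and c :: "'k \<Rightarrow> real" and \<alpha> \<beta> :: "'k \<Rightarrow> nat"
  assumes E: "finite E" "inj_on \<alpha> E" "inj_on \<beta> E"
    and c: "\<And>k. k \<in> E \<Longrightarrow> c k \<noteq> 0" and \<alpha>: "\<And>k. k \<in> E \<Longrightarrow> 0 < \<alpha> k"
    and z: "finite_sep X X z" and "0 < \<epsilon>"
    and dom: "\<And>T. u T \<in> X" "\<And>S. v S \<in> X"
    and kernel: "(\<forall>T S. z (u T) (v S) = (\<Sum>k\<in>E. c k * T ^ \<alpha> k * S ^ \<beta> k)) \<or>
      (\<forall>T S. z (v S) (u T) = (\<Sum>k\<in>E. c k * T ^ \<alpha> k * S ^ \<beta> k))"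
  shows "\<exists>R. eps_sep \<epsilon> X X z = enat R \<and> card E \<le> R"
proof -
  obtain R y' g g' where R: "eps_sep \<epsilon> X X z = enat R"
    and close: "\<And>A B. A \<in> X \<Longrightarrow> B \<in> X \<Longrightarrow> \<bar>y' A B - z A B\<bar> \<le> \<epsilon>"
    and y': "\<And>A B. A \<in> X \<Longrightarrow> B \<in> X \<Longrightarrow> y' A B = (\<Sum>r<R. g r A * g' r B)"
    using eps_sep_attained[OF z \<open>0 < \<epsilon>\<close>] by blast
  from kernel have "card E \<le> R"
  proof
    assume *: "\<forall>T S. z (u T) (v S) = (\<Sum>k\<in>E. c k * T ^ \<alpha> k * S ^ \<beta> k)"
    show ?thesis
    proof (rule approximate_monomial_kernel_rank[OF E c \<alpha>])
      show "\<bar>y' (u T) (v S) - (\<Sum>k\<in>E. c k * T ^ \<alpha> k * S ^ \<beta> k)\<bar> \<le> \<epsilon>" for T S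
        using close[OF dom] * by simp
      show "y' (u T) (v S) = (\<Sum>r<R. g r (u T) * g' r (v S))" for T S
        using y'[OF dom] .
    qed
  next
    assume *: "\<forall>T S. z (v S) (u T) = (\<Sum>k\<in>E. c k * T ^ \<alpha> k * S ^ \<beta> k)"
    show ?thesis
    proof (rule approximate_monomial_kernel_rank[OF E c \<alpha>])
      show "\<bar>y' (v S) (u T) - (\<Sum>k\<in>E. c k * T ^ \<alpha> k * S ^ \<beta> k)\<bar> \<le> \<epsilon>" for T S
        using close[OF dom(2,1)] * by simp
      show "y' (v S) (u T) = (\<Sum>r<R. g' r (u T) * g r (v S))" for T S
        using y'[OF dom(2,1)] by (simp add: mult.commute)
    qed
  qed
  with R show ?thesis by blast
qed

section \<open>Networks with selecting queries and keys\<close>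

text \<open>
  The rows of the query (key) matrices of all heads, stacked, select the coordinates
  \<open>\<sigma> 0, \<dots>, \<sigma> (s - 1)\<close> of their argument.
\<close>

definition selector :: "nat \<Rightarrow> nat \<Rightarrow> nat \<Rightarrow> (nat \<Rightarrow> nat) \<Rightarrow> nat \<Rightarrow> real mat" where
  "selector e d s \<sigma> h = mat e d (\<lambda>(r, q). of_bool (h * e + r < s \<and> q = \<sigma> (h * e + r)))"

lemma selector_mult_vec:
  assumes "v \<in> carrier_vec d" "r < e" "\<And>t. t < s \<Longrightarrow> \<sigma> t < d"
  shows "(selector e d s \<sigma> h *\<^sub>v v) $ r = (if h * e + r < s then v $ \<sigma> (h * e + r) else 0)"
proof -
  have "(selector e d s \<sigma> h *\<^sub>v v) $ r =
      (\<Sum>q\<in>{0..<d}. of_bool (h * e + r < s \<and> q = \<sigma> (h * e + r)) * v $ q)"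
    using assms(1,2) by (simp add: selector_def scalar_prod_def)
  also have "\<dots> = (\<Sum>q\<in>{0..<d}. if q = \<sigma> (h * e + r) then
      (if h * e + r < s then v $ \<sigma> (h * e + r) else 0) else 0)"
    by (rule sum.cong) auto
  finally show ?thesis using assms(3) by auto
qed

text \<open>The attention score of \<open>selector\<close> queries and keys, totalled over all
  heads.\<close>

definition pairing :: "nat \<Rightarrow> (nat \<Rightarrow> nat) \<Rightarrow> (nat \<Rightarrow> nat) \<Rightarrow> real vec \<Rightarrow> real vec \<Rightarrow> real" where
  "pairing s \<sigma> \<kappa> u v = (\<Sum>t<s. u $ \<sigma> t * v $ \<kappa> t)"

text \<open>The heads cut \<open>{..<d}\<close> into consecutive blocks of length
  \<open>d div H\<close>, so their inner products add up to that of the stacked vectors, in which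
  the rows from \<open>s\<close> on are zero.\<close>

lemma sum_heads_selector:
  assumes "H dvd d" "s \<le> d" "u \<in> carrier_vec d" "v \<in> carrier_vec d"
    and "\<And>t. t < s \<Longrightarrow> \<sigma> t < d" "\<And>t. t < s \<Longrightarrow> \<kappa> t < d"
  shows "(\<Sum>h<H. (selector (d div H) d s \<sigma> h *\<^sub>v u) \<bullet> (selector (d div H) d s \<kappa> h *\<^sub>v v)) =
    pairing s \<sigma> \<kappa> u v"
proof -
  define e where "e = d div H"
  define f where "f t = (if t < s then u $ \<sigma> t * v $ \<kappa> t else 0)" for t
  have "(selector e d s \<sigma> h *\<^sub>v u) \<bullet> (selector e d s \<kappa> h *\<^sub>v v) = (\<Sum>t\<in>{h * e..<h * e + e}. f t)" for h
  proof -
    have "(selector e d s \<sigma> h *\<^sub>v u) \<bullet> (selector e d s \<kappa> h *\<^sub>v v) = (\<Sum>r\<in>{0..<e}. f (r + h * e))"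
      unfolding scalar_prod_def
      by (rule sum.cong) (auto simp: selector_mult_vec assms f_def add.commute, auto simp: selector_def)
    also have "\<dots> = (\<Sum>t\<in>{0 + h * e..<e + h * e}. f t)"
      by (simp only: sum.shift_bounds_nat_ivl)
    finally show ?thesis by (simp add: add.commute)
  qed
  then have "(\<Sum>h<H. (selector e d s \<sigma> h *\<^sub>v u) \<bullet> (selector e d s \<kappa> h *\<^sub>v v)) = (\<Sum>t<H * e. f t)"
    by (simp add: sum.nat_group)
  also have "\<dots> = (\<Sum>t<d. f t)"
    using assms(1) by (simp add: e_def)
  also have "\<dots> = (\<Sum>t<s. f t)"
    using assms(2) by (intro sum.mono_neutral_right) (auto simp: f_def)
  finally show ?thesis by (simp add: pairing_def f_def e_def)
qed

text \<open>Every head sends the same number \<open>g j $ p * w\<close> through its coordinate 0 to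
  entry \<open>p\<close>. The heads differ only in their scores, whose sum is
  \<open>pairing\<close>.\<close>

lemma attn_selector_layer:
  assumes H: "H dvd d" "0 < d" and s: "s \<le> d" "\<And>t. t < s \<Longrightarrow> \<sigma> t < d" "\<And>t. t < s \<Longrightarrow> \<kappa> t < d"
    and p: "p < d" and i: "i < length xs"
    and W: "\<And>h. WQ W l h = selector (d div H) d s \<sigma> h" "\<And>h. WK W l h = selector (d div H) d s \<kappa> h"
      "\<And>h. WV W l h = mat (d div H) d (\<lambda>(r, q). if r = 0 \<and> q = p then w else 0)"
      "\<And>h. WO W l h = mat d (d div H) (\<lambda>(q, r). of_bool (q = p \<and> r = 0))"
    and g: "\<And>j. j < length xs \<Longrightarrow> attn W H d xs l j = g j" "\<And>j. j < length xs \<Longrightarrow> g j \<in> carrier_vec d"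
  shows "attn W H d xs (Suc l) i \<in> carrier_vec d"
    and "attn W H d xs (Suc l) i $ p = (\<Sum>j<length xs. pairing s \<sigma> \<kappa> (g i) (g j) * g j $ p) * w"
proof -
  define e where "e = d div H"
  have e: "0 < e" using H by (auto simp: e_def intro!: Nat.gr0I)
  define z where "z h = finsum_vec TYPE(real) e
      (\<lambda>j. ((selector e d s \<sigma> h *\<^sub>v g i) \<bullet> (selector e d s \<kappa> h *\<^sub>v g j)) \<cdot>\<^sub>v
        (mat e d (\<lambda>(r, q). if r = 0 \<and> q = p then w else 0) *\<^sub>v g j)) {..<length xs}" for h
  define O' :: "real mat" where "O' = mat d e (\<lambda>(q, r). of_bool (q = p \<and> r = 0))"
  have z_closed: "z h \<in> carrier_vec e" for h
    unfolding z_def by (intro finsum_vec_closed Pi_I carrier_vecI) simp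
  have V: "(mat e d (\<lambda>(r, q). if r = 0 \<and> q = p then w else 0) *\<^sub>v g j) $ 0 = g j $ p * w"
    if "j < length xs" for j
  proof -
    have "(mat e d (\<lambda>(r, q). if r = 0 \<and> q = p then w else 0) *\<^sub>v g j) $ 0 =
        (\<Sum>q\<in>{0..<d}. (if q = p then w else 0) * g j $ q)"
      using e g(2)[OF that] by (simp add: scalar_prod_def)
    also have "\<dots> = (\<Sum>q\<in>{0..<d}. if q = p then g j $ p * w else 0)"
      by (rule sum.cong) auto
    finally have "(mat e d (\<lambda>(r, q). if r = 0 \<and> q = p then w else 0) *\<^sub>v g j) $ 0 =
        (\<Sum>q\<in>{0..<d}. if q = p then g j $ p * w else 0)" .
    then show ?thesis using p by simp
  qed
  have z0: "z h $ 0 = (\<Sum>j<length xs.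
      (selector e d s \<sigma> h *\<^sub>v g i) \<bullet> (selector e d s \<kappa> h *\<^sub>v g j) * (g j $ p * w))" for h
  proof -
    have "z h $ 0 = (\<Sum>j<length xs. (((selector e d s \<sigma> h *\<^sub>v g i) \<bullet> (selector e d s \<kappa> h *\<^sub>v g j)) \<cdot>\<^sub>v
        (mat e d (\<lambda>(r, q). if r = 0 \<and> q = p then w else 0) *\<^sub>v g j)) $ 0)"
      unfolding z_def by (intro index_finsum_vec Pi_I carrier_vecI) (simp_all add: e)
    also have "\<dots> = (\<Sum>j<length xs.
        (selector e d s \<sigma> h *\<^sub>v g i) \<bullet> (selector e d s \<kappa> h *\<^sub>v g j) * (g j $ p * w))"
    proof (rule sum.cong[OF refl])
      fix j assume "j \<in> {..<length xs}"
      then have "j < length xs" by simp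
      have "dim_vec (mat e d (\<lambda>(r, q). if r = 0 \<and> q = p then w else 0) *\<^sub>v g j) = e" by simp
      then show "(((selector e d s \<sigma> h *\<^sub>v g i) \<bullet> (selector e d s \<kappa> h *\<^sub>v g j)) \<cdot>\<^sub>v
          (mat e d (\<lambda>(r, q). if r = 0 \<and> q = p then w else 0) *\<^sub>v g j)) $ 0 =
          (selector e d s \<sigma> h *\<^sub>v g i) \<bullet> (selector e d s \<kappa> h *\<^sub>v g j) * (g j $ p * w)"
        using V[OF \<open>j < length xs\<close>] e by (simp only: index_smult_vec(1))
    qed
    finally show ?thesis .
  qed
  have O'z: "(O' *\<^sub>v z h) $ p = z h $ 0" for h
  proof -
    have "(O' *\<^sub>v z h) $ p = (\<Sum>r\<in>{0..<e}. of_bool (r = 0) * z h $ r)"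
      using p z_closed[of h] by (simp add: O'_def scalar_prod_def)
    also have "\<dots> = (\<Sum>r\<in>{0..<e}. if r = 0 then z h $ 0 else 0)"
      by (rule sum.cong) auto
    finally have "(O' *\<^sub>v z h) $ p = (\<Sum>r\<in>{0..<e}. if r = 0 then z h $ 0 else 0)" .
    then show ?thesis using e by simp
  qed
  have step: "attn W H d xs (Suc l) i = finsum_vec TYPE(real) d (\<lambda>h. O' *\<^sub>v z h) {..<H}"
  proof -
    have "z h = finsum_vec TYPE(real) e
      (\<lambda>j. ((selector e d s \<sigma> h *\<^sub>v attn W H d xs l i) \<bullet> (selector e d s \<kappa> h *\<^sub>v attn W H d xs l j)) \<cdot>\<^sub>v
        (mat e d (\<lambda>(r, q). if r = 0 \<and> q = p then w else 0) *\<^sub>v attn W H d xs l j)) {..<length xs}" for h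
      unfolding z_def finsum_vec_def
      by (rule comm_monoid.finprod_cong'[OF comm_monoid_vec])
         (auto simp: g i monoid_vec_simps intro!: carrier_vecI)
    then show ?thesis by (simp add: W O'_def e_def)
  qed
  have O'z_closed: "(\<lambda>h. O' *\<^sub>v z h) \<in> {..<H} \<rightarrow> carrier_vec d"
    by (intro Pi_I carrier_vecI) (simp add: O'_def)
  show "attn W H d xs (Suc l) i \<in> carrier_vec d"
    unfolding step using O'z_closed by (rule finsum_vec_closed)
  have "attn W H d xs (Suc l) i $ p = (\<Sum>h<H. z h $ 0)"
    unfolding step using index_finsum_vec[OF _ p O'z_closed] by (simp add: O'z)
  also have "\<dots> = (\<Sum>j<length xs. (\<Sum>h<H. (selector e d s \<sigma> h *\<^sub>v g i) \<bullet> (selector e d s \<kappa> h *\<^sub>v g j)) *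
      (g j $ p * w))"
    unfolding z0 sum_distrib_right by (rule sum.swap)
  also have "\<dots> = (\<Sum>j<length xs. pairing s \<sigma> \<kappa> (g i) (g j) * (g j $ p * w))"
    unfolding e_def using g(2) i s H(1) by (intro sum.cong refl) (auto simp: sum_heads_selector)
  finally show "attn W H d xs (Suc l) i $ p = (\<Sum>j<length xs. pairing s \<sigma> \<kappa> (g i) (g j) * g j $ p) * w"
    by (simp add: sum_distrib_right mult.assoc)
qed

section \<open>An explicit network and its output\<close>

text \<open>Layers after layer 0 have a single nonzero query and key row, in head 0, so their score
  is the product of two entries \<open>p\<close>. The weight \<open>1 / real N\<close> cancels the
  \<open>N\<close> equal contributions of each sentence.\<close>

definition selector_network ::
  "nat \<Rightarrow> nat \<Rightarrow> nat \<Rightarrow> nat \<Rightarrow> nat \<Rightarrow> nat \<Rightarrow> (nat \<Rightarrow> nat) \<Rightarrow> (nat \<Rightarrow> nat) \<Rightarrow> network" where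
  "selector_network N H d V p s \<sigma> \<kappa> = \<lparr>
     WK = \<lambda>l. selector (d div H) d (if l = 0 then s else 1) (if l = 0 then \<kappa> else (\<lambda>_. p)),
     WQ = \<lambda>l. selector (d div H) d (if l = 0 then s else 1) (if l = 0 then \<sigma> else (\<lambda>_. p)),
     WV = \<lambda>l h. mat (d div H) d (\<lambda>(r, q). if r = 0 \<and> q = p then 1 / real N else 0),
     WO = \<lambda>l h. mat d (d div H) (\<lambda>(q, r). of_bool (q = p \<and> r = 0)),
     MV = mat d V (\<lambda>_. 1)\<rparr>"

lemma is_network_selector_network: "is_network L H d V (selector_network N H d V p s \<sigma> \<kappa>)"
  by (simp add: is_network_def selector_network_def selector_def)

text \<open>Entry \<open>p\<close> after layer 0 at a location of the sentence with inputs
  \<open>u\<close>, when the other sentence has inputs \<open>v\<close>.\<close>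

definition first_layer ::
  "nat \<Rightarrow> nat \<Rightarrow> (nat \<Rightarrow> nat) \<Rightarrow> (nat \<Rightarrow> nat) \<Rightarrow> real vec \<Rightarrow> real vec \<Rightarrow> real" where
  "first_layer p s \<sigma> \<kappa> u v = pairing s \<sigma> \<kappa> u u * u $ p + pairing s \<sigma> \<kappa> u v * v $ p"

lemma sum_two_blocks: "(\<Sum>j<2 * N. if j < N then x else y) = real N * (x + y)"
proof -
  have "{..<2 * N} \<inter> {j. j < N} = {..<N}" "{..<2 * N} \<inter> - {j. j < N} = {N..<2 * N}" by auto
  then show ?thesis by (simp add: sum.If_cases distrib_left)
qed

lemma half_pow3: "2 * ((3 ^ l - 1) div 2) + 1 = (3::nat) ^ l"
proof -
  have "odd ((3::nat) ^ l)" by simp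
  then show ?thesis by presburger
qed

text \<open>The recursion of the output exponent: each layer cubes the power of
  \<open>P\<^sup>2 + Q\<^sup>2\<close> already present and adds one more factor.\<close>

lemma half_pow3_Suc: "((3::nat) ^ Suc l - 1) div 2 = 3 * ((3 ^ l - 1) div 2) + 1"
  using half_pow3[of l] half_pow3[of "Suc l"] unfolding power_Suc by linarith

text \<open>
  After the first layer only entry \<open>p\<close> is used; there \<open>(x, y)\<close>, the values on the two sentences,
  becomes \<open>(x * (x\<^sup>2 + y\<^sup>2), y * (x\<^sup>2 + y\<^sup>2))\<close>.
\<close>

lemma attn_selector_network:
  fixes V :: nat
  assumes H: "H dvd d" "0 < d" and s: "s \<le> d" "\<And>t. t < s \<Longrightarrow> \<sigma> t < d" "\<And>t. t < s \<Longrightarrow> \<kappa> t < d"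
    and p: "p < d" and N: "0 < N" and ab: "a \<in> carrier_vec d" "b \<in> carrier_vec d" and i: "i < 2 * N"
  defines "W \<equiv> selector_network N H d V p s \<sigma> \<kappa>" and "xs \<equiv> replicate N a @ replicate N b"
    and "P \<equiv> first_layer p s \<sigma> \<kappa> a b" and "Q \<equiv> first_layer p s \<sigma> \<kappa> b a"
  shows "attn W H d xs (Suc l) i \<in> carrier_vec d \<and>
    attn W H d xs (Suc l) i $ p = (if i < N then P else Q) * (P\<^sup>2 + Q\<^sup>2) ^ ((3 ^ l - 1) div 2)"
  using i
proof (induction l arbitrary: i)
  case 0
  have len: "length xs = 2 * N" by (simp add: xs_def)
  define g where "g j = (if j < N then a else b)" for j
  have g: "attn W H d xs 0 j = g j" if "j < length xs" for j
    using that by (simp add: xs_def g_def nth_append)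
  have g': "g j \<in> carrier_vec d" for j
    using ab by (simp add: g_def)
  have i: "i < length xs" using 0 len by simp
  have W: "WQ W 0 h = selector (d div H) d s \<sigma> h" "WK W 0 h = selector (d div H) d s \<kappa> h"
    "WV W 0 h = mat (d div H) d (\<lambda>(r, q). if r = 0 \<and> q = p then 1 / real N else 0)"
    "WO W 0 h = mat d (d div H) (\<lambda>(q, r). of_bool (q = p \<and> r = 0))" for h
    by (simp_all add: W_def selector_network_def)
  note layer = attn_selector_layer[OF H s p i W g g']
  have "attn W H d xs (Suc 0) i $ p =
      (\<Sum>j<length xs. pairing s \<sigma> \<kappa> (g i) (g j) * g j $ p) * (1 / real N)"
    by (rule layer(2))
  also have "(\<Sum>j<length xs. pairing s \<sigma> \<kappa> (g i) (g j) * g j $ p) =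
      (\<Sum>j<2 * N. if j < N then pairing s \<sigma> \<kappa> (g i) a * a $ p else pairing s \<sigma> \<kappa> (g i) b * b $ p)"
    unfolding len by (rule sum.cong) (auto simp: g_def)
  also have "\<dots> = real N * (pairing s \<sigma> \<kappa> (g i) a * a $ p + pairing s \<sigma> \<kappa> (g i) b * b $ p)"
    by (rule sum_two_blocks)
  also have "\<dots> * (1 / real N) = (if i < N then P else Q)"
    using N by (simp add: g_def P_def Q_def first_layer_def)
  finally show ?case using layer(1) by simp
next
  case (Suc l)
  have len: "length xs = 2 * N" by (simp add: xs_def)
  have i: "i < length xs" using Suc.prems len by simp
  define g where "g = attn W H d xs (Suc l)"
  define n where "n = (3 ^ l - (1::nat)) div 2"
  define q where "q = P\<^sup>2 + Q\<^sup>2"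
  have g: "g j $ p = (if j < N then P else Q) * q ^ n" "g j \<in> carrier_vec d" if "j < length xs" for j
    using Suc.IH[of j] that unfolding g_def len n_def q_def by blast+
  have W: "WQ W (Suc l) h = selector (d div H) d 1 (\<lambda>_. p) h"
    "WK W (Suc l) h = selector (d div H) d 1 (\<lambda>_. p) h"
    "WV W (Suc l) h = mat (d div H) d (\<lambda>(r, q). if r = 0 \<and> q = p then 1 / real N else 0)"
    "WO W (Suc l) h = mat d (d div H) (\<lambda>(q, r). of_bool (q = p \<and> r = 0))" for h
    by (simp_all add: W_def selector_network_def)
  have "1 \<le> d" using H by simp
  note layer = attn_selector_layer[OF H this p p p i W fun_cong[OF g_def[symmetric]] g(2)]
  have "attn W H d xs (Suc (Suc l)) i $ p =
      (\<Sum>j<length xs. pairing 1 (\<lambda>_. p) (\<lambda>_. p) (g i) (g j) * g j $ p) * (1 / real N)"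
    by (rule layer(2))
  also have "(\<Sum>j<length xs. pairing 1 (\<lambda>_. p) (\<lambda>_. p) (g i) (g j) * g j $ p) =
      (\<Sum>j<2 * N. if j < N then g i $ p * (P * q ^ n)\<^sup>2 else g i $ p * (Q * q ^ n)\<^sup>2)"
    unfolding len[symmetric]
    by (rule sum.cong) (auto simp: pairing_def g(1) power2_eq_square)
  also have "\<dots> = real N * (g i $ p * (P * q ^ n)\<^sup>2 + g i $ p * (Q * q ^ n)\<^sup>2)"
    by (rule sum_two_blocks)
  also have "\<dots> * (1 / real N) = g i $ p * (q ^ n)\<^sup>2 * (P\<^sup>2 + Q\<^sup>2)"
    using N by (simp add: power_mult_distrib algebra_simps)
  also have "\<dots> = (if i < N then P else Q) * q ^ (3 * n + 1)"
    unfolding g(1)[OF i] q_def[symmetric] by (simp add: power2_eq_square power_add power_mult power3_eq_cube mult_ac)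
  finally show ?case
    using layer(1) unfolding half_pow3_Suc n_def q_def by blast
qed

lemma Z_selector_network:
  assumes "H dvd d" "0 < d" "s \<le> d" "\<And>t. t < s \<Longrightarrow> \<sigma> t < d" "\<And>t. t < s \<Longrightarrow> \<kappa> t < d"
    and "p < d" "0 < N" "i < 2 * N"
    and "length S1 = N" "length S2 = N" "set S1 \<subseteq> {..<V}" "set S2 \<subseteq> {..<V}"
    and "a \<in> carrier_vec d" "b \<in> carrier_vec d"
  shows "Z_in_context (selector_network N H d V p s \<sigma> \<kappa>) (Suc l) H d S1 S2 p i a b =
    (if i < N then first_layer p s \<sigma> \<kappa> a b else first_layer p s \<sigma> \<kappa> b a) *
    ((first_layer p s \<sigma> \<kappa> a b)\<^sup>2 + (first_layer p s \<sigma> \<kappa> b a)\<^sup>2) ^ ((3 ^ l - 1) div 2)"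
proof -
  have inputs: "map (\<lambda>w. embed (selector_network N H d V p s \<sigma> \<kappa>) w \<odot>\<^sub>v x) S = replicate (length S) x"
    if "set S \<subseteq> {..<V}" "x \<in> carrier_vec d" for S x
  proof -
    have "map (\<lambda>w. embed (selector_network N H d V p s \<sigma> \<kappa>) w \<odot>\<^sub>v x) S = map (\<lambda>_. x) S"
      using that by (intro map_cong refl eq_vecI)
        (auto simp: embed_def hadamard_def selector_network_def subset_eq)
    then show ?thesis by (simp add: map_replicate_const)
  qed
  show ?thesis
    unfolding Z_in_context_def using attn_selector_network[of H d s \<sigma> \<kappa> p N a b i V l] assms
    by (simp add: inputs del: attn.simps)
qed

lemma finite_sep_first_layer:
  "finite_sep X Y (first_layer p s \<sigma> \<kappa>)" "finite_sep X Y (\<lambda>u v. first_layer p s \<sigma> \<kappa> v u)"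
proof -
  have *: "finite_sep X Y (first_layer p s \<sigma> \<kappa>)" for X Y
  proof -
    have "finite_sep X Y (\<lambda>u v. \<Sum>t<s. u $ \<sigma> t * (v $ \<kappa> t * v $ p))"
      by (intro finite_sep_sum finite_sep_product)
    from finite_sep_add[OF finite_sep_product[of X Y "\<lambda>u. pairing s \<sigma> \<kappa> u u * u $ p" "\<lambda>_. 1"] this]
    show ?thesis
      by (rule finite_sep_cong) (simp add: first_layer_def pairing_def sum_distrib_right mult.assoc)
  qed
  then show "finite_sep X Y (first_layer p s \<sigma> \<kappa>)" .
  show "finite_sep X Y (\<lambda>u v. first_layer p s \<sigma> \<kappa> v u)"
    using finite_sep_swap[OF *] .
qed

text \<open>At a location of the second sentence the output formula has \<open>a\<close> and
  \<open>b\<close> exchanged, so there the curves \<open>u\<close> and \<open>v\<close> trade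
  places.\<close>

lemma eps_seq_sep_selector_network:
  fixes c :: "'k \<Rightarrow> real" and \<alpha> \<beta> :: "'k \<Rightarrow> nat" and u v :: "real \<Rightarrow> real vec"
  assumes W: "H dvd d" "0 < d" "s \<le> d" "\<And>t. t < s \<Longrightarrow> \<sigma> t < d" "\<And>t. t < s \<Longrightarrow> \<kappa> t < d"
      "p < d" "0 < N" "i < 2 * N"
      "length S1 = N" "length S2 = N" "set S1 \<subseteq> {..<V}" "set S2 \<subseteq> {..<V}"
    and "0 < \<epsilon>"
    and E: "finite E" "inj_on \<alpha> E" "inj_on \<beta> E"
    and c: "\<And>k. k \<in> E \<Longrightarrow> c k \<noteq> 0" and \<alpha>: "\<And>k. k \<in> E \<Longrightarrow> 0 < \<alpha> k"
    and dom: "\<And>T. u T \<in> carrier_vec d" "\<And>S. v S \<in> carrier_vec d"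
    and kernel: "\<And>T S. first_layer p s \<sigma> \<kappa> (u T) (v S) *
      ((first_layer p s \<sigma> \<kappa> (u T) (v S))\<^sup>2 + (first_layer p s \<sigma> \<kappa> (v S) (u T))\<^sup>2) ^ ((3 ^ l - 1) div 2) =
      (\<Sum>k\<in>E. c k * T ^ \<alpha> k * S ^ \<beta> k)"
  shows "\<exists>R. eps_seq_sep \<epsilon> (selector_network N H d V p s \<sigma> \<kappa>) (Suc l) H d S1 S2 p i = enat R \<and>
    card E \<le> R"
  unfolding eps_seq_sep_def
proof (rule eps_sep_ge_card[OF E c \<alpha> _ \<open>0 < \<epsilon>\<close> dom])
  note Z = Z_selector_network[OF W]
  let ?z = "Z_in_context (selector_network N H d V p s \<sigma> \<kappa>) (Suc l) H d S1 S2 p i"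
  have "finite_sep (carrier_vec d) (carrier_vec d)
      (if i < N then first_layer p s \<sigma> \<kappa> else (\<lambda>a b. first_layer p s \<sigma> \<kappa> b a))"
    by (simp add: finite_sep_first_layer)
  then have "finite_sep (carrier_vec d) (carrier_vec d) (\<lambda>a b.
      (if i < N then first_layer p s \<sigma> \<kappa> else (\<lambda>a b. first_layer p s \<sigma> \<kappa> b a)) a b *
      ((first_layer p s \<sigma> \<kappa> a b)\<^sup>2 + (first_layer p s \<sigma> \<kappa> b a)\<^sup>2) ^ ((3 ^ l - 1) div 2))"
    by (intro finite_sep_mult finite_sep_power finite_sep_add finite_sep_first_layer)
  then show "finite_sep (carrier_vec d) (carrier_vec d) ?z"
    by (rule finite_sep_cong) (simp add: Z)
  show "(\<forall>T S. ?z (u T) (v S) = (\<Sum>k\<in>E. c k * T ^ \<alpha> k * S ^ \<beta> k)) \<or>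
      (\<forall>T S. ?z (v S) (u T) = (\<Sum>k\<in>E. c k * T ^ \<alpha> k * S ^ \<beta> k))"
    using kernel by (cases "i < N") (simp_all add: Z dom add.commute)
qed

section \<open>Counting monomials\<close>

lemma coeff_mult_nonneg:
  fixes f g :: "real poly"
  assumes "\<And>i. 0 \<le> coeff f i" "\<And>i. 0 \<le> coeff g i"
  shows "0 \<le> coeff (f * g) i"
  using assms by (auto simp: coeff_mult intro!: sum_nonneg)

text \<open>Nonnegative coefficients cannot cancel, so one positive term of the convolution is
  enough.\<close>

lemma coeff_mult_pos:
  fixes f g :: "real poly"
  assumes "\<And>i. 0 \<le> coeff f i" "\<And>i. 0 \<le> coeff g i" "0 < coeff f a" "0 < coeff g b"
  shows "0 < coeff (f * g) (a + b)"
proof -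
  have "0 < coeff f a * coeff g (a + b - a)" using assms by simp
  also have "\<dots> \<le> (\<Sum>i\<le>a + b. coeff f i * coeff g (a + b - i))"
    using assms(1,2) by (intro member_le_sum) auto
  finally show ?thesis by (simp add: coeff_mult)
qed

text \<open>
  Each \<open>n < b ^ m\<close> is a sum of at most \<open>m * (b - 1)\<close> powers \<open>b ^ t\<close> with \<open>t < m\<close>, by its digits
  in base \<open>b\<close>.
\<close>

lemma coeff_power_sum_of_powers_pos:
  fixes b m :: nat
  assumes b: "0 < b" and n: "n < b ^ m" and D: "m * (b - 1) \<le> D"
  defines "q \<equiv> 1 + (\<Sum>t<m. monom (1::real) (b ^ t))"
  shows "0 < coeff (q ^ D) n"
proof -
  have q: "0 \<le> coeff q i" for i
    by (auto simp: q_def coeff_sum intro!: add_nonneg_nonneg sum_nonneg)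
  have nonneg: "0 \<le> coeff (q ^ k) i" for k i
    by (induction k arbitrary: i) (auto intro!: coeff_mult_nonneg q)
  have add: "0 < coeff (q ^ (k + k')) (a + a')"
    if "0 < coeff (q ^ k) a" "0 < coeff (q ^ k') a'" for k k' a a'
    unfolding power_add using that by (intro coeff_mult_pos nonneg)
  have q0: "0 < coeff q 0"
    by (auto simp: q_def coeff_sum intro!: add_pos_nonneg sum_nonneg)
  have qt: "0 < coeff q (b ^ t)" if "t < m" for t
  proof -
    have "0 < (\<Sum>t'<m. coeff (monom (1::real) (b ^ t')) (b ^ t))"
      using that by (intro sum_pos2[of _ t]) auto
    then show ?thesis
      by (auto simp: q_def coeff_sum intro!: add_nonneg_pos)
  qed
  \<comment> \<open>The constant term of \<open>q\<close> absorbs surplus factors.\<close>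
  have zero: "0 < coeff (q ^ k) 0" for k
    using q0 by (induction k) (auto simp: coeff_mult)
  have multiple: "0 < coeff (q ^ k) (k * b ^ t)" if "t < m" for k t
    using add[of 1 "b ^ t"] qt[OF that] by (induction k) auto
  have digits: "0 < coeff (q ^ (j * (b - 1))) n" if "j \<le> m" "n < b ^ j" for j n
    using that
  proof (induction j arbitrary: n)
    case (Suc j)
    define x where "x = n div b ^ j"
    have "x < b"
      using Suc.prems(2) unfolding x_def by (intro less_mult_imp_div_less) (simp add: mult.commute)
    \<comment> \<open>The leading digit \<open>x\<close> takes the monomial of degree
      \<open>b ^ j\<close> from \<open>x\<close> factors and the constant term from the other
      \<open>b - 1 - x\<close>.\<close>
    have "0 < coeff (q ^ (j * (b - 1) + (x + (b - 1 - x)))) (n mod b ^ j + (x * b ^ j + 0))"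
      using Suc b by (intro add multiple zero Suc.IH) auto
    moreover have "n mod b ^ j + (x * b ^ j + 0) = n"
      by (simp add: x_def mod_div_mult_eq)
    moreover have "j * (b - 1) + (x + (b - 1 - x)) = Suc j * (b - 1)"
      using \<open>x < b\<close> by simp
    ultimately show ?case by (simp only:)
  qed (simp add: zero)
  have "0 < coeff (q ^ (m * (b - 1) + (D - m * (b - 1)))) (n + 0)"
    by (intro add digits zero n) simp
  then show ?thesis using D by simp
qed

section \<open>Rank bounds for small and large width\<close>

text \<open>With both curves supported at entry \<open>p\<close>, the binomial theorem expands the
  output into \<open>M + 1\<close> monomials. The exponents of \<open>T\<close> are odd, hence
  positive.\<close>

lemma eps_seq_sep_small_width:
  assumes "H dvd d" "p < d" "0 < N" "i < 2 * N"
    "length S1 = N" "length S2 = N" "set S1 \<subseteq> {..<V}" "set S2 \<subseteq> {..<V}" "0 < \<epsilon>"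
  shows "\<exists>W R. is_network (Suc l) H d V W \<and>
    eps_seq_sep \<epsilon> W (Suc l) H d S1 S2 p i = enat R \<and> (3 ^ Suc l - 1) div 2 + 1 \<le> R"
proof -
  define M where "M = (3 ^ Suc l - (1::nat)) div 2"
  define u where "u T = vec d (\<lambda>q. if q = p then T else (0::real))" for T
  have u: "u T \<in> carrier_vec d" "u T $ p = T" for T
    using \<open>p < d\<close> by (auto simp: u_def)
  have "\<exists>R. eps_seq_sep \<epsilon> (selector_network N H d V p 1 (\<lambda>_. p) (\<lambda>_. p)) (Suc l) H d S1 S2 p i =
      enat R \<and> card {..M} \<le> R"
  proof (rule eps_seq_sep_selector_network)
    fix T S :: real
    define q where "q = T\<^sup>2 + S\<^sup>2"
    define n where "n = (3 ^ l - (1::nat)) div 2"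
    have "first_layer p 1 (\<lambda>_. p) (\<lambda>_. p) (u T) (u S) = T * q"
      "first_layer p 1 (\<lambda>_. p) (\<lambda>_. p) (u S) (u T) = S * q"
      by (simp_all add: first_layer_def pairing_def u q_def power2_eq_square algebra_simps)
    moreover have "T * q * ((T * q)\<^sup>2 + (S * q)\<^sup>2) ^ n = T * q ^ M"
    proof -
      have "(T * q)\<^sup>2 + (S * q)\<^sup>2 = q ^ 3"
        unfolding power_mult_distrib distrib_right[symmetric] q_def[symmetric]
        by (simp add: power2_eq_square power3_eq_cube)
      moreover have "M = 3 * n + 1"
        unfolding M_def n_def by (rule half_pow3_Suc)
      ultimately show ?thesis by (simp add: power_mult mult.assoc)
    qed
    moreover have "T * q ^ M = (\<Sum>k\<le>M. real (M choose k) * T ^ (2 * k + 1) * S ^ (2 * (M - k)))"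
      unfolding q_def binomial_ring sum_distrib_left
      by (rule sum.cong) (auto simp: mult_ac simp flip: power_mult)
    ultimately show "first_layer p 1 (\<lambda>_. p) (\<lambda>_. p) (u T) (u S) *
        ((first_layer p 1 (\<lambda>_. p) (\<lambda>_. p) (u T) (u S))\<^sup>2 +
          (first_layer p 1 (\<lambda>_. p) (\<lambda>_. p) (u S) (u T))\<^sup>2) ^ ((3 ^ l - 1) div 2) =
        (\<Sum>k\<le>M. real (M choose k) * T ^ (2 * k + 1) * S ^ (2 * (M - k)))"
      by (simp add: n_def)
    show "inj_on (\<lambda>k. 2 * k + 1) {..M}" "inj_on (\<lambda>k. 2 * (M - k)) {..M}"
      by (auto intro!: inj_onI)
  qed (use assms u in auto)
  then show ?thesis
    using is_network_selector_network unfolding M_def by (metis Suc_eq_plus1 card_atMost)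
qed

text \<open>The curves \<open>u\<close> and \<open>v\<close> have disjoint supports, and only
  \<open>v\<close> is nonzero at \<open>p\<close>. So \<open>first_layer\<close> is \<open>r\<close>
  in one order and 0 in the other, and the sum of squares collapses. The bound
  \<open>2 * m + 3\<close> counts two blocks of \<open>m + 1\<close> entries and
  \<open>p\<close>.\<close>

lemma eps_seq_sep_large_width:
  assumes W: "H dvd d" "p < d" "0 < N" "i < 2 * N"
      "length S1 = N" "length S2 = N" "set S1 \<subseteq> {..<V}" "set S2 \<subseteq> {..<V}" "0 < \<epsilon>"
    and m: "2 * m + 3 \<le> d" and b: "0 < b" "m * (b - 1) \<le> 3 ^ l"
  shows "\<exists>W R. is_network (Suc l) H d V W \<and>
    eps_seq_sep \<epsilon> W (Suc l) H d S1 S2 p i = enat R \<and> b ^ m \<le> R"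
proof -
  define D where "D = (3::nat) ^ l"
  \<comment> \<open>Taking out one factor \<open>T * S\<close> leaves the exponents 0 and
    \<open>b ^ t\<close> of the polynomial \<open>q\<close>.\<close>
  define e where "e t = (case t of 0 \<Rightarrow> 1 | Suc t \<Rightarrow> 1 + b ^ t)" for t
  \<comment> \<open>\<open>f\<close> enumerates the entries other than \<open>p\<close>, with left
    inverse \<open>f'\<close>; the first \<open>Suc m\<close> of them serve \<open>u\<close>, the
    next \<open>Suc m\<close> serve \<open>v\<close>.\<close>
  define f where "f t = (if t < p then t else Suc t)" for t
  define f' where "f' q = (if q < p then q else q - 1)" for q
  have f: "f t < d" "f t \<noteq> p" "f' (f t) = t" if "t < 2 * Suc m" for t
    using that m by (auto simp: f_def f'_def)
  define u where "u T = vec d (\<lambda>q. if q \<noteq> p \<and> f' q \<le> m then T ^ e (f' q) else (0::real))" for T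
  define v where "v S = vec d (\<lambda>q. if q = p then 1 else if f' q \<le> m then 0 else S ^ e (f' q - Suc m))"
    for S :: real
  have uv: "u T \<in> carrier_vec d" "v S \<in> carrier_vec d" "u T $ p = 0" "v S $ p = 1" for T S
    using W(2) by (auto simp: u_def v_def)
  have uv_f: "u T $ f t = T ^ e t" "v S $ f t = 0" "v S $ f (Suc m + t) = S ^ e t" if "t < Suc m" for T S t
    using that f[of t] f[of "Suc m + t"] by (auto simp: u_def v_def)
  define \<kappa> where "\<kappa> t = f (Suc m + t)" for t
  define r where "r T S = (\<Sum>t<Suc m. T ^ e t * S ^ e t)" for T S :: real
  define q where "q = 1 + (\<Sum>t<m. monom (1::real) (b ^ t))"
  define E where "E = {k. coeff (q ^ D) k \<noteq> 0}"
  have r: "r T S = T * S * poly q (T * S)" for T S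
  proof -
    have "r T S = T * S + (\<Sum>t<m. T * S * (T * S) ^ (b ^ t))"
      unfolding r_def by (subst sum.lessThan_Suc_shift) (simp add: e_def power_mult_distrib mult_ac)
    then show ?thesis
      by (simp add: q_def poly_sum poly_monom distrib_left sum_distrib_left)
  qed
  have E_sub: "E \<subseteq> {..degree (q ^ D)}"
    by (auto simp: E_def le_degree)
  have rD: "r T S ^ D = (\<Sum>k\<in>E. coeff (q ^ D) k * T ^ (k + D) * S ^ (k + D))" for T S
  proof -
    have "r T S ^ D = (T * S) ^ D * poly (q ^ D) (T * S)"
      unfolding r by (simp add: power_mult_distrib)
    also have "poly (q ^ D) (T * S) = (\<Sum>k\<in>E. coeff (q ^ D) k * (T * S) ^ k)"
      unfolding poly_altdef by (rule sum.mono_neutral_right) (use E_sub in \<open>auto simp: E_def\<close>)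
    also have "(T * S) ^ D * \<dots> = (\<Sum>k\<in>E. coeff (q ^ D) k * T ^ (k + D) * S ^ (k + D))"
      unfolding sum_distrib_left
      by (rule sum.cong) (simp_all add: power_mult_distrib power_add mult_ac)
    finally show ?thesis .
  qed
  have "{..<b ^ m} \<subseteq> E"
  proof
    fix n assume "n \<in> {..<b ^ m}"
    then have "0 < coeff (q ^ D) n"
      unfolding q_def D_def by (intro coeff_power_sum_of_powers_pos b) simp
    then show "n \<in> E" by (simp add: E_def)
  qed
  moreover have finE: "finite E"
    using E_sub by (rule finite_subset) simp
  ultimately have card: "b ^ m \<le> card E"
    using card_mono[of E "{..<b ^ m}"] by simp
  have "\<exists>R. eps_seq_sep \<epsilon> (selector_network N H d V p (Suc m) f \<kappa>) (Suc l) H d S1 S2 p i =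
      enat R \<and> card E \<le> R"
  proof (rule eps_seq_sep_selector_network)
    fix T S :: real
    have "pairing (Suc m) f \<kappa> (u T) (v S) = r T S"
      unfolding pairing_def r_def \<kappa>_def by (rule sum.cong) (simp_all only: lessThan_iff uv_f)
    then have "first_layer p (Suc m) f \<kappa> (u T) (v S) = r T S"
      by (simp add: first_layer_def uv)
    moreover have "first_layer p (Suc m) f \<kappa> (v S) (u T) = 0"
      unfolding first_layer_def pairing_def by (simp add: uv uv_f)
    moreover have "r T S * ((r T S)\<^sup>2) ^ ((3 ^ l - 1) div 2) = r T S ^ D"
    proof -
      have "D = Suc (2 * ((3 ^ l - 1) div 2))"
        using half_pow3[of l] by (simp only: D_def Suc_eq_plus1)
      then show ?thesis by (simp only: power_Suc power_mult)
    qed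
    ultimately show "first_layer p (Suc m) f \<kappa> (u T) (v S) *
        ((first_layer p (Suc m) f \<kappa> (u T) (v S))\<^sup>2 +
          (first_layer p (Suc m) f \<kappa> (v S) (u T))\<^sup>2) ^ ((3 ^ l - 1) div 2) =
        (\<Sum>k\<in>E. coeff (q ^ D) k * T ^ (k + D) * S ^ (k + D))"
      by (simp add: rD)
    show "f t < d" "\<kappa> t < d" if "t < Suc m" for t
      using f(1)[of t] f(1)[of "Suc m + t"] that by (auto simp: \<kappa>_def)
    \<comment> \<open>The factor \<open>(T * S) ^ D\<close> makes even the exponent belonging to the
      constant term of \<open>q ^ D\<close> positive.\<close>
    show "coeff (q ^ D) k \<noteq> 0" "0 < k + D" if "k \<in> E" for k
      using that by (auto simp: E_def D_def)
  qed (use W m uv finE in auto)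
  then show ?thesis
    using is_network_selector_network card by (meson order_trans)
qed

section \<open>Logarithms of the rank bounds\<close>

text \<open>The rank is at least \<open>2 ^ L\<close>, and \<open>ln 2 \<ge> 1 / 2\<close> exceeds
  \<open>5 / 12\<close>, which bounds \<open>d / 12\<close>.\<close>

lemma width_depth_bound_small:
  fixes d L :: nat
  assumes "d \<le> 5" "1 \<le> A" "real ((3 ^ L - 1) div 2 + 1) \<le> x"
  shows "1 / 12 * (real L * real d) / A \<le> ln x"
proof -
  have "2 * 2 ^ L \<le> (3::nat) ^ L + 1"
  proof (induction L)
    case (Suc L)
    have "1 \<le> (3::nat) ^ L" by simp
    with Suc show ?case unfolding power_Suc by linarith
  qed simp
  then have "(2::nat) ^ L \<le> (3 ^ L - 1) div 2 + 1"
    using half_pow3[of L] by linarith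
  then have "2 ^ L \<le> x"
    using assms(3) by (metis of_nat_mono of_nat_numeral of_nat_power order_trans)
  then have "ln (2 ^ L) \<le> ln x"
    by (intro ln_mono) (auto intro: less_le_trans[of 0 "2 ^ L"])
  then have *: "real L * ln 2 \<le> ln x"
    by (simp add: ln_realpow)
  have "1 / 2 \<le> ln (2::real)"
    using ln_le_minus_one[of "1 / 2"] by (simp add: ln_div)
  then have "real L * (1 / 2) \<le> real L * ln 2"
    by (intro mult_left_mono) auto
  moreover have "1 / 12 * (real L * real d) / A \<le> 1 / 12 * (real L * real d)"
    using assms(2) mult_left_mono[of 1 A "1 / 12 * (real L * real d)"]
    by (subst pos_divide_le_eq) auto
  moreover have "real L * real d \<le> real L * 5"
    using assms(1) by (intro mult_left_mono) auto
  ultimately show ?thesis using * by linarith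
qed

text \<open>From \<open>3 ^ Suc l \<le> d * b\<close> follows
  \<open>Suc l \<le> ln d + ln b\<close>, and \<open>ln b \<ge> 1\<close> merges this into
  \<open>(1 + ln d) * ln b\<close>, at the cost of one logarithmic factor. The constant comes from
  \<open>d \<le> 12 * m\<close>.\<close>

lemma width_depth_bound_large:
  fixes d l :: nat
  assumes "6 \<le> d" "d < 3 * 3 ^ l" "1 + ln (real d) \<le> A"
    "real ((3 ^ l div (d div 6) + 1) ^ (d div 6)) \<le> x"
  shows "1 / 12 * (real (Suc l) * real d) / A \<le> ln x"
proof -
  define m where "m = d div 6"
  define b where "b = 3 ^ l div m + 1"
  have m: "0 < m" "6 * m \<le> d"
    using assms(1) by (simp_all add: m_def div_greater_zero_iff)
  then have d_le: "d \<le> 12 * m"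
    unfolding m_def by linarith
  \<comment> \<open>Here \<open>d < 3 ^ L\<close> enters: it forces \<open>b \<ge> 3\<close>, hence
    \<open>ln b \<ge> 1\<close>.\<close>
  have "2 * m \<le> 3 ^ l"
    using m(2) assms(2) by linarith
  then have "3 \<le> b"
    using m(1) by (simp add: b_def less_eq_div_iff_mult_less_eq)
  have "3 ^ l < m * b"
    using m(1) dividend_less_times_div[of m "3 ^ l"] by (simp add: b_def)
  then have "3 ^ Suc l \<le> 3 * m * b" by simp
  also have "\<dots> \<le> d * b"
    using m(2) by (intro mult_right_mono) auto
  finally have "real (3 ^ Suc l) \<le> real (d * b)"
    by (rule of_nat_mono)
  then have "ln (3 ^ Suc l) \<le> ln (real d * real b)"
    by (intro ln_mono) auto
  then have upper: "real (Suc l) * ln 3 \<le> ln (real d) + ln (real b)"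
    using assms(1) \<open>3 \<le> b\<close> by (subst (asm) ln_realpow) (auto simp: ln_mult)
  have ln3: "1 \<le> ln (3::real)"
    using exp_le by (subst ln_ge_iff) auto
  then have "real (Suc l) * 1 \<le> real (Suc l) * ln 3"
    by (intro mult_left_mono) auto
  from order.trans[OF this upper] have L: "real (Suc l) \<le> ln (real d) + ln (real b)" by simp
  have "ln 3 \<le> ln (real b)"
    using \<open>3 \<le> b\<close> by (intro ln_mono) auto
  then have b1: "1 \<le> ln (real b)" using ln3 by linarith
  have d0: "0 \<le> ln (real d)" using assms(1) by simp
  have "real (Suc l) \<le> (1 + ln (real d)) * ln (real b)"
    using L mult_left_mono[OF b1 d0] by (simp add: distrib_right)
  also have "\<dots> \<le> A * ln (real b)"
    using assms(3) b1 by (intro mult_right_mono) auto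
  finally have LA: "real (Suc l) \<le> A * ln (real b)" .
  have A: "0 < A" using assms(3) d0 by linarith
  have "1 / 12 * (real (Suc l) * real d) = real (Suc l) * (real d / 12)" by simp
  also have "\<dots> \<le> (A * ln (real b)) * real m"
    using LA d_le A b1 by (intro mult_mono) auto
  finally have "1 / 12 * (real (Suc l) * real d) / A \<le> real m * ln (real b)"
    using A by (subst pos_divide_le_eq) (auto simp: mult_ac)
  also have "\<dots> = ln (real b ^ m)"
    using \<open>3 \<le> b\<close> by (simp add: ln_realpow)
  also have "\<dots> \<le> ln x"
    using assms(4) \<open>3 \<le> b\<close> unfolding m_def[symmetric] b_def[symmetric]
    by (intro ln_mono) (auto intro: less_le_trans[of 0 "real b ^ m"])
  finally show ?thesis .
qed

theorem theorem2:
  fixes C :: real and k :: nat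
  assumes "C > 0"
  shows "\<exists>c>0. \<exists>m::nat.
    \<forall>(N::nat) (L::nat) (H::nat) (d::nat) (V::nat)
      (S1::nat list) (S2::nat list) (p::nat) (i::nat) (\<epsilon>::real).
      N \<ge> 1 \<and> L \<ge> 1 \<and> H \<ge> 1 \<and> d \<ge> 1 \<and> V \<ge> 1 \<and> H dvd d \<and> real L > log 3 (real d) \<and>
      length S1 = N \<and> length S2 = N \<and> set S1 \<subseteq> {..<V} \<and> set S2 \<subseteq> {..<V} \<and>
      p < d \<and> i < 2 * N \<and>
      0 < \<epsilon> \<and> \<epsilon> \<le> C * arch_log L H d ^ k * inverse (real ((3 ^ L + d - 1) choose (3 ^ L)))
      \<longrightarrow> (\<exists>W. is_network L H d V W \<and>
            (\<exists>R::nat. eps_seq_sep \<epsilon> W L H d S1 S2 p i = enat R \<and>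
               ln (real R) \<ge> c * (real L * real d) / arch_log L H d ^ m))"
proof (intro exI[of _ "1 / 12 :: real"] conjI exI[of _ "1::nat"] allI impI; (elim conjE)?)
  fix N L H d V p i :: nat and S1 S2 :: "nat list" and \<epsilon> :: real
  assume L: "1 \<le> L" and H: "1 \<le> H" "H dvd d" and d: "1 \<le> d" "log 3 (real d) < real L"
    and rest: "1 \<le> N" "length S1 = N" "length S2 = N" "set S1 \<subseteq> {..<V}" "set S2 \<subseteq> {..<V}"
      "p < d" "i < 2 * N" "0 < \<epsilon>"
  obtain l where l: "L = Suc l" using L by (cases L) auto
  have W: "H dvd d" "p < d" "0 < N" "i < 2 * N" "length S1 = N" "length S2 = N"
      "set S1 \<subseteq> {..<V}" "set S2 \<subseteq> {..<V}" "0 < \<epsilon>"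
    using H rest by auto
  have A: "1 + ln (real d) \<le> arch_log L H d" "1 \<le> arch_log L H d"
    using L H d by (auto simp: arch_log_def)
  show "\<exists>W. is_network L H d V W \<and> (\<exists>R. eps_seq_sep \<epsilon> W L H d S1 S2 p i = enat R \<and>
      1 / 12 * (real L * real d) / arch_log L H d ^ 1 \<le> ln (real R))"
  \<comment> \<open>From width 6 on, \<open>d div 6\<close> is positive and there is room for both
    blocks of entries; below that, \<open>d\<close> is bounded and a rank exponential in
    \<open>L\<close> alone suffices.\<close>
  proof (cases "d \<le> 5")
    case True
    obtain W R where "is_network L H d V W" "eps_seq_sep \<epsilon> W L H d S1 S2 p i = enat R"
      and R: "(3 ^ L - 1) div 2 + 1 \<le> R"
      using eps_seq_sep_small_width[OF W] unfolding l by blast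
    moreover have "1 / 12 * (real L * real d) / arch_log L H d \<le> ln (real R)"
      using width_depth_bound_small[OF True A(2)] R by (metis of_nat_mono)
    ultimately show ?thesis by auto
  next
    case False
    define m where "m = d div 6"
    define b where "b = 3 ^ l div m + 1"
    have "2 * m + 3 \<le> d" using False by (simp add: m_def)
    moreover have "0 < b" "m * (b - 1) \<le> 3 ^ l" by (simp_all add: b_def)
    ultimately obtain W R where "is_network L H d V W" "eps_seq_sep \<epsilon> W L H d S1 S2 p i = enat R"
      and R: "b ^ m \<le> R"
      using eps_seq_sep_large_width[OF W] unfolding l by blast
    moreover have "1 / 12 * (real L * real d) / arch_log L H d \<le> ln (real R)"
    proof -
      have "real d < 3 powr real L"
        using d by (subst (asm) log_less_iff) auto
      then have "real d < real (3 ^ L)" by (simp add: powr_realpow)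
      then have "d < 3 * 3 ^ l" unfolding l of_nat_less_iff by simp
      moreover have "6 \<le> d" using False by simp
      moreover have "real ((3 ^ l div (d div 6) + 1) ^ (d div 6)) \<le> real R"
        using R unfolding m_def b_def by (rule of_nat_mono)
      ultimately show ?thesis
        using width_depth_bound_large A(1) unfolding l by blast
    qed
    ultimately show ?thesis by auto
  qed
qed simp

end
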